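(* Let $\alpha\ge0$, let $T$ be a $(C,\alpha)$-bounded operator on a complex Banach space $X$ with $\overline{(I-T)X}=X$, and let $0<s<1$. For $x\in X$ the following assertions are equivalent: (i) $x\in\operatorname{Ran}(I-T)^s$. (ii) The series $\sum_{n=1}^\infty\frac{1}{n^{1+\alpha-s}}\Delta^{-\alpha}\mathcal T(n)x$ converges in norm. (iii) The series $\sum_{n=1}^\infty\frac{1}{n^{1+\alpha-s}}\Delta^{-\alpha}\mathcal T(n)x$ converges weakly in $X$. Furthermore, if (i), (ii) or (iii) holds, then $$(I-T)^{-s}x=\frac{\sin(\pi s)\,\Gamma(1-s+\alpha)}{\pi}\sum_{n=0}^\infty\frac{\Gamma(s+n)}{\Gamma(n+\alpha+1)}\Delta^{-\alpha}\mathcal T(n)x.$$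
   Context: For $\alpha\in\mathbb R$: $k^\alpha(0)=1$, $k^\alpha(n)=\frac{\alpha(\alpha+1)\cdots(\alpha+n-1)}{n!}$ for $n\ge1$ (coefficients of $(1-z)^{-\alpha}$). For $T\in\mathcal B(X)$: $\Delta^{-\alpha}\mathcal T(n)=\sum_{j=0}^nk^\alpha(n-j)T^j$, and $T$ is $(C,\alpha)$-bounded if $\sup_n\|\Delta^{-\alpha}\mathcal T(n)\|/k^{\alpha+1}(n)<\infty$. For $0<s<1$, the operator $(I-T)^s\in\mathcal B(X)$ is defined by the functional calculus applied to $(1-z)^s=\sum_nk^{-s}(n)z^n$, that is, $(I-T)^s:=\sum_{n=0}^\infty D^\alpha k^{-s}(n)\,\Delta^{-\alpha}\mathcal T(n)$ (absolutely convergent), where $D^\alpha f(n)=\sum_{j=n}^\infty k^{-\alpha}(j-n)f(j)$. Under the hypotheses $I-T$ and $(I-T)^s$ are injective, and $(I-T)^{-s}:=((I-T)^s)^{-1}$ with domain $\operatorname{Ran}(I-T)^s$. *)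

theory Defs
  imports "HOL-Analysis.Analysis"
begin

class scaleC =
  fixes scaleC :: "complex \<Rightarrow> 'a \<Rightarrow> 'a"  (infixr \<open>*\<^sub>C\<close> 75)

text \<open>A complex Banach space is a real Banach space with a compatible complex scalar
  multiplication; \<open>1 *\<^sub>C x = x\<close> follows from \<open>scaleR_scaleC\<close>.\<close>

class complex_banach = banach + scaleC +
  assumes scaleC_add_right: "a *\<^sub>C (x + y) = a *\<^sub>C x + a *\<^sub>C y"
    and scaleC_add_left: "(a + b) *\<^sub>C x = a *\<^sub>C x + b *\<^sub>C x"
    and scaleC_scaleC: "a *\<^sub>C (b *\<^sub>C x) = (a * b) *\<^sub>C x"
    and scaleR_scaleC: "r *\<^sub>R x = complex_of_real r *\<^sub>C x"
    and norm_scaleC: "norm (a *\<^sub>C x) = cmod a * norm x"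

instantiation complex :: complex_banach
begin

definition scaleC_complex :: "complex \<Rightarrow> complex \<Rightarrow> complex" where
  "scaleC_complex a x = a * x"

instance
  by standard (simp_all add: scaleC_complex_def algebra_simps scaleR_conv_of_real norm_mult)

end

text \<open>Elements of \<open>'a \<Rightarrow>\<^sub>L 'b\<close> are bounded and real-linear. Those satisfying the following
  predicate are exactly the bounded complex-linear maps, and their norm in \<open>'a \<Rightarrow>\<^sub>L 'b\<close> is the
  usual operator norm.\<close>

definition complex_linear :: "('a::complex_banach \<Rightarrow>\<^sub>L 'b::complex_banach) \<Rightarrow> bool" where
  "complex_linear f \<longleftrightarrow> (\<forall>c x. f (c *\<^sub>C x) = c *\<^sub>C f x)"

primrec blinfun_power :: "('a::real_normed_vector \<Rightarrow>\<^sub>L 'a) \<Rightarrow> nat \<Rightarrow> ('a \<Rightarrow>\<^sub>L 'a)" where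
  "blinfun_power T 0 = id_blinfun"
| "blinfun_power T (Suc n) = T o\<^sub>L blinfun_power T n"

definition cesaro_number :: "real \<Rightarrow> nat \<Rightarrow> real" where
  "cesaro_number \<alpha> n = pochhammer \<alpha> n / fact n"

text \<open>\<open>cesaro_sum \<alpha> T n\<close> is \<open>\<Delta>\<^sup>-\<^sup>\<alpha>\<T>(n)\<close>.\<close>

definition cesaro_sum ::
    "real \<Rightarrow> ('a::real_normed_vector \<Rightarrow>\<^sub>L 'a) \<Rightarrow> nat \<Rightarrow> ('a \<Rightarrow>\<^sub>L 'a)" where
  "cesaro_sum \<alpha> T n = (\<Sum>j\<le>n. cesaro_number \<alpha> (n - j) *\<^sub>R blinfun_power T j)"

definition cesaro_bounded :: "real \<Rightarrow> ('a::real_normed_vector \<Rightarrow>\<^sub>L 'a) \<Rightarrow> bool" where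
  "cesaro_bounded \<alpha> T \<longleftrightarrow>
     bdd_above (range (\<lambda>n. norm (cesaro_sum \<alpha> T n) / cesaro_number (\<alpha> + 1) n))"

text \<open>The Weyl difference \<open>D\<^sup>\<alpha>f(n) = \<Sum>\<^sub>j\<^sub>\<ge>\<^sub>n k\<^sup>-\<^sup>\<alpha>(j - n) f(j)\<close>, summed over \<open>i = j - n\<close>.\<close>

definition weyl_difference :: "real \<Rightarrow> (nat \<Rightarrow> real) \<Rightarrow> nat \<Rightarrow> real" where
  "weyl_difference \<alpha> f n = (\<Sum>i. cesaro_number (- \<alpha>) i * f (n + i))"

text \<open>\<open>frac_power \<alpha> s T\<close> is \<open>(I - T)\<^sup>s\<close> for a \<open>(C,\<alpha>)\<close>-bounded \<open>T\<close> and \<open>0 < s < 1\<close>; the series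
  is taken in operator norm.\<close>

definition frac_power :: "real \<Rightarrow> real \<Rightarrow> ('a::banach \<Rightarrow>\<^sub>L 'a) \<Rightarrow> ('a \<Rightarrow>\<^sub>L 'a)" where
  "frac_power \<alpha> s T =
     (\<Sum>n. weyl_difference \<alpha> (cesaro_number (- s)) n *\<^sub>R cesaro_sum \<alpha> T n)"

text \<open>\<open>(I - T)\<^sup>-\<^sup>s\<close>, meaningful only on \<open>range (frac_power \<alpha> s T)\<close>.\<close>

definition frac_power_inverse :: "real \<Rightarrow> real \<Rightarrow> ('a::banach \<Rightarrow>\<^sub>L 'a) \<Rightarrow> 'a \<Rightarrow> 'a" where
  "frac_power_inverse \<alpha> s T = the_inv (blinfun_apply (frac_power \<alpha> s T))"

definition weakly_summable :: "(nat \<Rightarrow> 'a::complex_banach) \<Rightarrow> bool" where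
  "weakly_summable u \<longleftrightarrow>
     (\<exists>y. \<forall>\<phi> :: 'a \<Rightarrow>\<^sub>L complex. complex_linear \<phi> \<longrightarrow> (\<lambda>n. \<phi> (u n)) sums \<phi> y)"

end

theory Submission
  imports Defs "HOL-Real_Asymp.Real_Asymp"
begin

text \<open>
  Write \<open>S\<^sub>n = \<Delta>\<^sup>-\<^sup>\<alpha>\<T>(n)\<close> and let \<open>R\<^sub>N\<close> be the \<open>N\<close>-th partial sum of the claimed series for
  \<open>(I - T)\<^sup>-\<^sup>s\<close>. Everything follows from \<open>R\<^sub>N (I - T)\<^sup>s \<longrightarrow> I\<close> strongly: this gives the implication from
  (i) to (ii), injectivity and the formula, and since \<open>R\<^sub>N\<close> commutes with \<open>(I - T)\<^sup>s\<close>, a weak limit \<open>y\<close> of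
  \<open>R\<^sub>N x\<close> satisfies \<open>(I - T)\<^sup>s y = x\<close>.

  On the dense range of \<open>I - T\<close> the convergence is a summation by parts, which yields
  \<open>R\<^sub>N (I - T) \<longrightarrow> (I - T)\<^sup>1\<^sup>-\<^sup>s\<close> in norm. What remains is that \<open>R\<^sub>N (I - T)\<^sup>s\<close> is bounded, and this is seen by
  comparison with the Abel regularisations \<open>(I - rT)\<^sup>\<plusminus>\<^sup>s\<close> at \<open>1 - r = 1/(N + 1)\<close>. They are
  controlled by the following principle: if \<open>f\<close> is completely monotone, then its Weyl difference
  \<open>D\<^sup>\<alpha>f\<close> is nonnegative, so that the norm of \<open>\<Sum> f(n) T\<^sup>n = \<Sum> D\<^sup>\<alpha>f(j) S\<^sub>j\<close> is at most
  \<open>C \<Sum> D\<^sup>\<alpha>f(j) k\<^sup>\<alpha>\<^sup>+\<^sup>1(j) = C \<Sum> f(n)\<close>.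
\<close>

section \<open>Cesaro numbers\<close>

text \<open>The termwise bound on \<open>R_N\<close> is only \<open>O(N^s)\<close>, so the
  boundedness of \<open>R_N (I - T)^s\<close> cannot be read off from its factors. The coefficients
  of \<open>R_N\<close> are, formally, the Weyl differences of \<open>k^s\<close>. They are
  normalised so that their increments are the Weyl coefficients of \<open>(I - T)^(1-s)\<close>,
  which is why the summation by parts closes up. The positivity principle does not apply to
  \<open>(I - T)^s\<close> itself, since \<open>k^(-s)(n)\<close> is negative at
  \<open>n = 1\<close> but not at \<open>n = 0\<close>. It applies to
  \<open>k^(-s)(n) (r^n - 1)\<close> for \<open>n \<ge> 1\<close>, whose sum is
  \<open>(1 - r)^s\<close>, and this controls the error of the Abel regularisation. The series in
  (ii) and the series in the formula have coefficients with relative difference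
  \<open>O(1/n)\<close>, so that they differ by an absolutely convergent series. The step from weak
  limits to equations in \<open>X\<close> needs complex functionals that separate points; these are
  built by Zorn's lemma.\<close>

lemma cesaro_number_0 [simp]: "cesaro_number a 0 = 1"
  by (simp add: cesaro_number_def)

lemma cesaro_number_Suc: "cesaro_number a (Suc n) = cesaro_number a n * (a + n) / Suc n"
  by (simp add: cesaro_number_def pochhammer_Suc field_simps)

lemma cesaro_number_zero [simp]: "cesaro_number 0 n = (if n = 0 then 1 else 0)"
  by (simp add: cesaro_number_def pochhammer_0_left)

lemma cesaro_number_one [simp]: "cesaro_number 1 n = 1"
  by (induction n) (simp_all add: cesaro_number_Suc field_simps)

lemma cesaro_number_minus_one:
  "cesaro_number (-1) n = (if n = 0 then 1 else if n = 1 then -1 else 0)"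
proof (induction n)
  case (Suc n)
  then show ?case by (cases n) (auto simp: cesaro_number_Suc)
qed simp

lemma cesaro_number_pos: "a > 0 \<Longrightarrow> cesaro_number a n > 0"
  by (simp add: cesaro_number_def pochhammer_pos)

lemma cesaro_number_nonneg: "a \<ge> 0 \<Longrightarrow> cesaro_number a n \<ge> 0"
  using cesaro_number_pos[of a n] by (cases "a = 0") auto

text \<open>Coefficientwise form of \<open>(1 - z)^(-a) (1 - z)^(-b) = (1 - z)^(-(a + b))\<close>.
  The formulas for sums and differences below rest on the case \<open>b = 1\<close>.\<close>

lemma cesaro_number_convolution:
  "(\<Sum>j\<le>n. cesaro_number a j * cesaro_number b (n - j)) = cesaro_number (a + b) n"
  unfolding cesaro_number_def pochhammer_binomial_sum sum_divide_distrib
  by (intro sum.cong refl) (simp add: binomial_fact field_simps)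

lemma sum_cesaro_number: "(\<Sum>j\<le>n. cesaro_number a j) = cesaro_number (a + 1) n"
  using cesaro_number_convolution[of a 1 n] by simp

lemma cesaro_number_diff:
  "cesaro_number a (Suc n) - cesaro_number a n = cesaro_number (a - 1) (Suc n)"
  using sum_cesaro_number[of "a - 1" "Suc n"] sum_cesaro_number[of "a - 1" n] by simp

lemma abs_cesaro_number_le: "\<bar>cesaro_number a n\<bar> \<le> cesaro_number \<bar>a\<bar> n"
proof (induction n)
  case (Suc n)
  have "\<bar>cesaro_number a n * (a + n)\<bar> \<le> cesaro_number \<bar>a\<bar> n * (\<bar>a\<bar> + n)"
    unfolding abs_mult by (intro mult_mono Suc.IH) (auto simp: cesaro_number_nonneg)
  then show ?case by (simp add: cesaro_number_Suc divide_right_mono)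
qed simp

lemma abs_cesaro_number_le_1:
  assumes "\<bar>a\<bar> \<le> 1"
  shows "\<bar>cesaro_number a n\<bar> \<le> 1"
proof (induction n)
  case (Suc n)
  have "\<bar>cesaro_number a n\<bar> * \<bar>a + n\<bar> \<le> 1 * real (Suc n)"
    using assms by (intro mult_mono Suc) auto
  then show ?case by (simp add: cesaro_number_Suc abs_mult)
qed simp

lemma cesaro_number_plus_one_times: "a * cesaro_number (a + 1) n = (a + n) * cesaro_number a n"
proof -
  have "a * pochhammer (a + 1) n = pochhammer a n * (a + n)"
    by (metis pochhammer_Suc pochhammer_rec)
  then show ?thesis by (simp add: cesaro_number_def mult.commute)
qed

lemma Suc_times_cesaro_number_le:
  assumes "b \<ge> 1"
  shows "real (Suc n) * cesaro_number b n \<le> b * cesaro_number (b + 1) n"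
proof -
  have "real (Suc n) * cesaro_number b n \<le> (b + n) * cesaro_number b n"
    using assms by (intro mult_right_mono cesaro_number_nonneg) auto
  then show ?thesis by (simp add: cesaro_number_plus_one_times)
qed

lemma cesaro_number_Suc_le:
  assumes "a \<ge> 0"
  shows "cesaro_number (a + 1) (Suc n) \<le> (a + 1) * cesaro_number (a + 1) n"
proof -
  have "(a + 1 + n) / Suc n \<le> a + 1"
    using assms by (simp add: field_simps)
  then have "cesaro_number (a + 1) n * ((a + 1 + n) / Suc n) \<le> cesaro_number (a + 1) n * (a + 1)"
    using assms by (intro mult_left_mono cesaro_number_nonneg) auto
  then show ?thesis by (simp add: cesaro_number_Suc mult.commute)
qed

lemma cesaro_number_sums:
  assumes "0 \<le> r" "r < 1"
  shows "(\<lambda>n. cesaro_number a n * r ^ n) sums ((1 - r) powr (- a))"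
proof -
  have "(\<lambda>n. ((- a) gchoose n) * (- r) ^ n) sums (1 + (- r)) powr (- a)"
    using assms by (intro gen_binomial_real) auto
  moreover have "((- a) gchoose n) * (- r) ^ n = cesaro_number a n * r ^ n" for n
    by (simp add: gbinomial_pochhammer cesaro_number_def power_minus[of r])
  ultimately show ?thesis by simp
qed

lemma cesaro_number_minus_nonpos:
  assumes "0 \<le> s" "s \<le> 1"
  shows "cesaro_number (- s) (Suc n) \<le> 0"
proof (induction n)
  case 0
  then show ?case using assms by (simp add: cesaro_number_Suc)
next
  case (Suc n)
  have "cesaro_number (- s) (Suc n) * (- s + Suc n) \<le> 0"
    using Suc assms by (intro mult_nonpos_nonneg) auto
  then show ?case
    by (subst cesaro_number_Suc) (simp add: divide_nonpos_nonneg)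
qed

lemma cesaro_number_minus_Suc:
  "cesaro_number (- s) (Suc n) = - s * cesaro_number (1 - s) n / Suc n"
  by (simp add: cesaro_number_def pochhammer_rec)

text \<open>For \<open>0 \<le> t < 1\<close> the signs of \<open>k^(-t)\<close> are known, and
  passing from \<open>t\<close> to \<open>t + 1\<close> is a first difference. Facts about arbitrary
  real orders are reduced to these two cases.\<close>

lemma real_ge_0_induct [consumes 1, case_names base step]:
  fixes a :: real
  assumes "a \<ge> 0"
    and base: "\<And>t. 0 \<le> t \<Longrightarrow> t < 1 \<Longrightarrow> P t"
    and step: "\<And>t. 0 \<le> t \<Longrightarrow> P t \<Longrightarrow> P (t + 1)"
  shows "P a"
proof -
  have "P (frac a + real n)" for n
  proof (induction n)
    case 0
    then show ?case using base[of "frac a"] by (simp add: frac_lt_1)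
  next
    case (Suc n)
    then show ?case using step[of "frac a + real n"] by (simp add: add_ac)
  qed
  from this[of "nat \<lfloor>a\<rfloor>"] show ?thesis
    using assms(1) by (simp add: frac_def)
qed

text \<open>No term after the one at 0 is positive, so the absolute values add up to 2 minus the
  signed sum.\<close>

lemma sum_cesaro_number_minus:
  assumes "0 \<le> s" "s \<le> 1"
  shows "(\<Sum>j\<le>n. \<bar>cesaro_number (- s) j\<bar>) = 2 - cesaro_number (1 - s) n"
proof -
  have "(\<Sum>j\<le>n. \<bar>cesaro_number (- s) j\<bar>) = (\<Sum>j\<le>n. 2 * of_bool (j = 0) - cesaro_number (- s) j)"
  proof (intro sum.cong refl)
    fix j show "\<bar>cesaro_number (- s) j\<bar> = 2 * of_bool (j = 0) - cesaro_number (- s) j"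
      using cesaro_number_minus_nonpos[OF assms, of "j - 1"] by (cases j) auto
  qed
  also have "\<dots> = 2 - cesaro_number (1 - s) n"
    by (simp add: sum_subtractf sum_cesaro_number flip: sum_distrib_left)
  finally show ?thesis .
qed

lemma summable_abs_cesaro_number_minus:
  assumes "0 \<le> s" "s \<le> 1"
  shows "summable (\<lambda>n. \<bar>cesaro_number (- s) n\<bar>)"
proof (rule bounded_imp_summable)
  show "(\<Sum>k\<le>n. \<bar>cesaro_number (- s) k\<bar>) \<le> 2" for n
    unfolding sum_cesaro_number_minus[OF assms] using assms by (simp add: cesaro_number_nonneg)
qed simp

text \<open>A bound uniform in \<open>n\<close> makes the Weyl difference of every absolutely
  summable sequence converge. In the induction step, \<open>k^(-t-1)\<close> is the first difference
  of \<open>k^(-t)\<close>.\<close>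

lemma cesaro_number_minus_bounded:
  assumes "a \<ge> 0"
  shows "\<exists>M>0. \<forall>n. \<bar>cesaro_number (- a) n\<bar> \<le> M"
  using assms
proof (induction rule: real_ge_0_induct)
  case (base t)
  have "\<bar>cesaro_number (- t) n\<bar> \<le> 2" for n
  proof -
    have "\<bar>cesaro_number (- t) n\<bar> \<le> (\<Sum>j\<le>n. \<bar>cesaro_number (- t) j\<bar>)"
      by (intro member_le_sum) auto
    also have "\<dots> \<le> 2"
      using base by (subst sum_cesaro_number_minus) (auto simp: cesaro_number_nonneg)
    finally show ?thesis .
  qed
  then show ?case by (intro exI[of _ 2]) auto
next
  case (step t)
  then obtain M where M: "M > 0" "\<And>n. \<bar>cesaro_number (- t) n\<bar> \<le> M" by auto
  have "\<bar>cesaro_number (- (t + 1)) n\<bar> \<le> 2 * M + 1" for n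
  proof (cases n)
    case (Suc m)
    have "- (t + 1) = - t - 1" by simp
    then show ?thesis
      using cesaro_number_diff[of "- t" m] M(2)[of m] M(2)[of n] Suc by auto
  qed (use M in simp)
  then show ?case using M by (intro exI[of _ "2 * M + 1"]) auto
qed

text \<open>After division by \<open>(n + 1)^(a - 1)\<close>, the number \<open>k^a(n)\<close> is
  the approximation \<open>rGamma_series\<close> of \<open>1 / Gamma a\<close> times factors that
  tend to 1. It therefore converges and is bounded.\<close>

lemma cesaro_number_bigo:
  assumes "a > 0"
  shows "\<exists>C>0. \<forall>n. cesaro_number a n \<le> C * real (Suc n) powr (a - 1)"
proof -
  have ev: "\<forall>\<^sub>F n in sequentially. cesaro_number a n / real (Suc n) powr (a - 1) =
      rGamma_series a n * (real n / (n + a)) * (real n / Suc n) powr (a - 1)"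
    using eventually_gt_at_top[of 0]
  proof eventually_elim
    case (elim n)
    then have "a + real n > 0" "real n > 0" using assms by auto
    moreover have "exp (a * ln (real n)) = real n * real n powr (a - 1)"
      using elim by (simp add: powr_diff) (simp add: powr_def)
    ultimately show ?case
      by (simp add: rGamma_series_def cesaro_number_def pochhammer_Suc powr_divide add.commute)
  qed
  have "(\<lambda>n. rGamma_series a n * (real n / (n + a)) * (real n / Suc n) powr (a - 1))
      \<longlonglongrightarrow> rGamma a * 1 * 1"
  proof (intro tendsto_mult rGamma_series_LIMSEQ)
    show "(\<lambda>n. real n / (real n + a)) \<longlonglongrightarrow> 1" by real_asymp
    show "(\<lambda>n. (real n / real (Suc n)) powr (a - 1)) \<longlonglongrightarrow> 1" by real_asymp
  qed
  then have "(\<lambda>n. cesaro_number a n / real (Suc n) powr (a - 1)) \<longlonglongrightarrow> rGamma a * 1 * 1"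
    using tendsto_cong[OF ev] by blast
  then have "Bseq (\<lambda>n. cesaro_number a n / real (Suc n) powr (a - 1))"
    by (intro convergent_imp_Bseq convergentI)
  then obtain C where C: "C > 0"
      "\<And>n. norm (cesaro_number a n / real (Suc n) powr (a - 1)) \<le> C"
    by (elim BseqE) auto
  have "cesaro_number a n \<le> C * real (Suc n) powr (a - 1)" for n
    using C(2)[of n] cesaro_number_pos[OF assms, of n] by (simp add: field_simps)
  then show ?thesis using C(1) by auto
qed

text \<open>The value of \<open>(1 - z)^s\<close> at \<open>z = 1\<close>: the partial sums are
  \<open>k^(1-s)(N)\<close>, which tend to 0.\<close>

lemma cesaro_number_minus_sums:
  assumes "0 < s" "s < 1"
  shows "cesaro_number (- s) sums 0"
proof -
  obtain C where C: "\<And>n. cesaro_number (1 - s) n \<le> C * real (Suc n) powr (1 - s - 1)"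
    using cesaro_number_bigo[of "1 - s"] assms by auto
  have "(\<lambda>n. cesaro_number (1 - s) n) \<longlonglongrightarrow> 0"
  proof (rule tendsto_sandwich[OF _ _ tendsto_const])
    show "(\<lambda>n. C * real (Suc n) powr (1 - s - 1)) \<longlonglongrightarrow> 0" using assms by real_asymp
  qed (use C assms in \<open>auto simp: cesaro_number_nonneg\<close>)
  then show ?thesis
    unfolding sums_def_le by (simp add: sum_cesaro_number)
qed

section \<open>Completely monotone sequences\<close>

definition drop_diff :: "(nat \<Rightarrow> real) \<Rightarrow> nat \<Rightarrow> real" where
  "drop_diff f n = f n - f (Suc n)"

text \<open>By Hausdorff's theorem these are the moment sequences of positive measures on
  \<open>[0, 1]\<close>, which is the origin of the examples below.\<close>

definition completely_monotone :: "(nat \<Rightarrow> real) \<Rightarrow> bool" where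
  "completely_monotone f \<longleftrightarrow> (\<forall>k n. 0 \<le> (drop_diff ^^ k) f n)"

lemma completely_monotone_nonneg: "completely_monotone f \<Longrightarrow> 0 \<le> f n"
  unfolding completely_monotone_def by (metis funpow_0)

lemma completely_monotone_drop_diff:
  "completely_monotone f \<Longrightarrow> completely_monotone (drop_diff f)"
  unfolding completely_monotone_def by (metis comp_apply funpow_Suc_right)

lemma completely_monotone_Suc: "completely_monotone f \<Longrightarrow> f (Suc n) \<le> f n"
  using completely_monotone_nonneg[OF completely_monotone_drop_diff, of f n]
  by (simp add: drop_diff_def)

lemma completely_monotone_antimono: "completely_monotone f \<Longrightarrow> m \<le> n \<Longrightarrow> f n \<le> f m"
  by (rule lift_Suc_antimono_le[of f]) (auto intro: completely_monotone_Suc)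

lemma completely_monotone_shift:
  assumes "completely_monotone f"
  shows "completely_monotone (\<lambda>n. f (Suc n))"
proof -
  have "(drop_diff ^^ k) (\<lambda>n. f (Suc n)) = (\<lambda>n. (drop_diff ^^ k) f (Suc n))" for k
    by (induction k) (simp_all add: drop_diff_def fun_eq_iff)
  with assms show ?thesis by (simp add: completely_monotone_def)
qed

lemma drop_diff_pow_add:
  "(drop_diff ^^ k) (\<lambda>n. f n + g n) = (\<lambda>n. (drop_diff ^^ k) f n + (drop_diff ^^ k) g n)"
  by (induction k) (simp_all add: drop_diff_def fun_eq_iff)

lemma drop_diff_pow_scale:
  "(drop_diff ^^ k) (\<lambda>n. c * f n) = (\<lambda>n. c * (drop_diff ^^ k) f n)"
  by (induction k) (simp_all add: drop_diff_def fun_eq_iff algebra_simps)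

lemma completely_monotone_scale:
  "completely_monotone f \<Longrightarrow> c \<ge> 0 \<Longrightarrow> completely_monotone (\<lambda>n. c * f n)"
  by (simp add: completely_monotone_def drop_diff_pow_scale)

text \<open>A Leibniz rule: one difference of the product is \<open>drop_diff f\<close> times
  \<open>g\<close> plus the shifted \<open>f\<close> times \<open>drop_diff g\<close>. Both are
  again products of completely monotone sequences, so the induction ranges over all \<open>f\<close>
  and \<open>g\<close>.\<close>

lemma completely_monotone_mult:
  assumes "completely_monotone f" "completely_monotone g"
  shows "completely_monotone (\<lambda>n. f n * g n)"
proof -
  have "0 \<le> (drop_diff ^^ k) (\<lambda>n. f n * g n) n" for k n
    using assms
  proof (induction k arbitrary: f g n)
    case 0
    then show ?case by (simp add: completely_monotone_nonneg)
  next
    case (Suc k)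
    have "drop_diff (\<lambda>n. f n * g n) = (\<lambda>n. drop_diff f n * g n + f (Suc n) * drop_diff g n)"
      by (simp add: drop_diff_def fun_eq_iff algebra_simps)
    then show ?case
      using Suc.IH[of "drop_diff f" g n] Suc.IH[of "\<lambda>n. f (Suc n)" "drop_diff g" n] Suc.prems
      by (simp add: funpow_Suc_right drop_diff_pow_add completely_monotone_drop_diff
          completely_monotone_shift del: funpow.simps)
  qed
  then show ?thesis by (simp add: completely_monotone_def)
qed

text \<open>For \<open>a < b\<close> these are the moments of a Beta distribution. One difference
  yields a nonnegative multiple of the same ratio with \<open>b + 1\<close> in place of
  \<open>b\<close>, so the induction varies \<open>b\<close>.\<close>

lemma completely_monotone_pochhammer_ratio:
  fixes a b :: real
  assumes "0 < a" "a \<le> b"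
  shows "completely_monotone (\<lambda>n. pochhammer a n / pochhammer b n)"
proof -
  have "0 \<le> (drop_diff ^^ k) (\<lambda>n. pochhammer a n / pochhammer b n) n" for k n
    using assms
  proof (induction k arbitrary: b n)
    case 0
    then show ?case by (simp add: pochhammer_nonneg)
  next
    case (Suc k)
    have "drop_diff (\<lambda>n. pochhammer a n / pochhammer b n) =
        (\<lambda>n. (b - a) / b * (pochhammer a n / pochhammer (b + 1) n))"
    proof
      fix n
      have pos: "pochhammer b n > 0" "b + n > 0" "b > 0" using Suc.prems by (auto intro: pochhammer_pos)
      have eq: "b * pochhammer (b + 1) n = pochhammer b n * (b + n)"
        by (metis pochhammer_Suc pochhammer_rec)
      have "drop_diff (\<lambda>n. pochhammer a n / pochhammer b n) n =
          (b - a) * pochhammer a n / (pochhammer b n * (b + n))"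
        using pos by (simp add: drop_diff_def pochhammer_Suc divide_simps) (simp add: algebra_simps)
      then show "drop_diff (\<lambda>n. pochhammer a n / pochhammer b n) n =
          (b - a) / b * (pochhammer a n / pochhammer (b + 1) n)"
        by (simp flip: eq)
    qed
    then have "(drop_diff ^^ Suc k) (\<lambda>n. pochhammer a n / pochhammer b n) n =
        (b - a) / b * (drop_diff ^^ k) (\<lambda>n. pochhammer a n / pochhammer (b + 1) n) n"
      by (simp only: funpow_Suc_right comp_apply drop_diff_pow_scale)
    moreover have "(b - a) / b * (drop_diff ^^ k) (\<lambda>n. pochhammer a n / pochhammer (b + 1) n) n \<ge> 0"
      using Suc.IH[of "b + 1" n] Suc.prems by (intro mult_nonneg_nonneg) auto
    ultimately show ?case by simp
  qed
  then show ?thesis by (simp add: completely_monotone_def)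
qed

lemma completely_monotone_cesaro_number:
  "0 < b \<Longrightarrow> b \<le> 1 \<Longrightarrow> completely_monotone (cesaro_number b)"
  using completely_monotone_pochhammer_ratio[of b 1]
  by (simp add: cesaro_number_def[abs_def] pochhammer_fact)

lemma completely_monotone_power:
  assumes "0 \<le> r" "r \<le> 1"
  shows "completely_monotone (\<lambda>n. r ^ n)"
proof -
  have "(drop_diff ^^ k) (\<lambda>n. r ^ n) = (\<lambda>n. (1 - r) ^ k * r ^ n)" for k
    by (induction k) (simp_all add: drop_diff_def fun_eq_iff algebra_simps)
  then show ?thesis using assms by (simp add: completely_monotone_def)
qed

text \<open>This is the moment sequence of Lebesgue measure on \<open>[r, 1]\<close>.\<close>

lemma completely_monotone_power_integral:
  assumes "0 \<le> r" "r \<le> 1"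
  shows "completely_monotone (\<lambda>n. (1 - r ^ Suc n) / Suc n)"
proof -
  \<comment> \<open>Each difference multiplies the integrand by \<open>1 - u\<close>, which is
    nonnegative on the interval.\<close>
  have int: "((\<lambda>u. u ^ n * (1 - u) ^ k) has_integral
      (drop_diff ^^ k) (\<lambda>n. (1 - r ^ Suc n) / Suc n) n) {r..1}" for n k
  proof (induction k arbitrary: n)
    case 0
    have "((\<lambda>u. u ^ n) has_integral (1 ^ Suc n / Suc n - r ^ Suc n / Suc n)) {r..1}"
    proof (rule fundamental_theorem_of_calculus)
      show "((\<lambda>u. u ^ Suc n / Suc n) has_vector_derivative x ^ n) (at x within {r..1})" for x
        unfolding has_real_derivative_iff_has_vector_derivative[symmetric]
        by (rule derivative_eq_intros refl | simp)+
    qed (use assms in auto)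
    then show ?case by (simp add: diff_divide_distrib)
  next
    case (Suc k)
    show ?case
      using has_integral_diff[OF Suc.IH[of n] Suc.IH[of "Suc n"]]
      by (simp add: drop_diff_def algebra_simps)
  qed
  have "0 \<le> (drop_diff ^^ k) (\<lambda>n. (1 - r ^ Suc n) / Suc n) n" for k n
    by (rule has_integral_nonneg[OF int]) (use assms in auto)
  then show ?thesis by (simp add: completely_monotone_def)
qed

section \<open>Weyl differences\<close>

text \<open>Rearrangement of a double series along the diagonals \<open>j + i = n\<close>. The
  hypothesis concerns finite diagonal sums only; the bijection between \<open>(n, j)\<close> and
  \<open>(j, n - j)\<close> carries it over to absolute summability on all pairs, hence on every
  row.\<close>

lemma triangle_sums:
  fixes g :: "nat \<Rightarrow> nat \<Rightarrow> 'b::banach"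
  assumes "summable (\<lambda>n. \<Sum>j\<le>n. norm (g j (n - j)))"
  obtains S where "(\<lambda>n. \<Sum>j\<le>n. g j (n - j)) sums S" "(\<lambda>j. \<Sum>i. g j i) sums S"
    "\<And>j. summable (\<lambda>i. norm (g j i))"
proof -
  define f where "f = (\<lambda>(n, j). g j (n - j))"
  have "(\<lambda>p. norm (f p)) summable_on Sigma UNIV (\<lambda>n. {..n})"
  proof (rule iffD2[OF Infinite_Sum.abs_summable_on_Sigma_iff], intro conjI ballI)
    show "(\<lambda>n. norm (\<Sum>\<^sub>\<infinity>j\<in>{..n}. norm (f (n, j)))) summable_on UNIV"
      using assms by (simp add: f_def summable_on_UNIV_nonneg_real_iff sum_nonneg)
  qed simp
  moreover have "(\<lambda>p. norm (f p)) summable_on Sigma UNIV (\<lambda>n. {..n}) \<longleftrightarrow>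
      (\<lambda>p. norm (case_prod g p)) summable_on Sigma UNIV (\<lambda>_. UNIV)"
    by (rule summable_on_reindex_bij_witness[where j = "\<lambda>(n, j). (j, n - j)" and i = "\<lambda>(j, i). (i + j, j)"])
      (auto simp: f_def)
  ultimately have abs: "(\<lambda>p. norm (case_prod g p)) summable_on Sigma UNIV (\<lambda>_. UNIV)" by simp
  then have "case_prod g summable_on Sigma UNIV (\<lambda>_. UNIV)" by (rule abs_summable_summable)
  then obtain S where S: "(case_prod g has_sum S) (Sigma UNIV (\<lambda>_. UNIV))"
    by (auto simp: summable_on_def)
  have gj: "summable (\<lambda>i. norm (g j i))" for j
    using iffD1[OF Infinite_Sum.abs_summable_on_Sigma_iff abs]
    by (auto intro: summable_on_imp_summable)
  have "((\<lambda>j. \<Sum>i. g j i) has_sum S) UNIV"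
  proof (rule has_sum_SigmaD[OF S])
    show "((\<lambda>i. case (j, i) of (j, i) \<Rightarrow> g j i) has_sum (\<Sum>i. g j i)) UNIV" for j
      using norm_summable_imp_has_sum[OF gj[of j]] summable_norm_cancel[OF gj[of j]]
      by (simp add: summable_sums)
  qed
  then have 1: "(\<lambda>j. \<Sum>i. g j i) sums S" by (rule has_sum_imp_sums)
  have "(f has_sum S) (Sigma UNIV (\<lambda>n. {..n})) \<longleftrightarrow> (case_prod g has_sum S) (Sigma UNIV (\<lambda>_. UNIV))"
    by (rule has_sum_reindex_bij_witness[where j = "\<lambda>(n, j). (j, n - j)" and i = "\<lambda>(j, i). (i + j, j)"])
      (auto simp: f_def)
  with S have "(f has_sum S) (Sigma UNIV (\<lambda>n. {..n}))" by simp
  then have "((\<lambda>n. \<Sum>j\<le>n. f (n, j)) has_sum S) UNIV"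
    by (rule has_sum_SigmaD) (auto intro: has_sum_finite)
  then have 2: "(\<lambda>n. \<Sum>j\<le>n. g j (n - j)) sums S"
    by (auto simp: f_def dest: has_sum_imp_sums)
  show thesis by (rule that[OF 2 1 gj])
qed

lemma summable_weyl_difference:
  assumes "a \<ge> 0" "summable (\<lambda>n. \<bar>f n\<bar>)"
  shows "summable (\<lambda>i. \<bar>cesaro_number (- a) i * f (j + i)\<bar>)"
proof -
  obtain M where M: "M > 0" "\<And>n. \<bar>cesaro_number (- a) n\<bar> \<le> M"
    using cesaro_number_minus_bounded[OF assms(1)] by auto
  have "summable (\<lambda>i. \<bar>f (j + i)\<bar>)"
    using summable_iff_shift[of "\<lambda>n. \<bar>f n\<bar>" j] assms(2) by (simp add: add.commute)
  then have "summable (\<lambda>i. M * \<bar>f (j + i)\<bar>)" by (rule summable_mult)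
  then show ?thesis
    by (rule summable_comparison_test'[where N = 0]) (auto simp: abs_mult intro!: mult_right_mono M)
qed

lemma abs_weyl_difference_le:
  assumes "\<And>n. \<bar>cesaro_number (- a) n\<bar> \<le> M" "summable (\<lambda>n. \<bar>f n\<bar>)"
  shows "\<bar>weyl_difference a f j\<bar> \<le> M * (\<Sum>i. \<bar>f (j + i)\<bar>)"
proof -
  have s: "summable (\<lambda>i. \<bar>f (j + i)\<bar>)"
    using summable_iff_shift[of "\<lambda>n. \<bar>f n\<bar>" j] assms(2) by (simp add: add.commute)
  then have s2: "summable (\<lambda>i. M * \<bar>f (j + i)\<bar>)" by (rule summable_mult)
  have s3: "summable (\<lambda>i. \<bar>cesaro_number (- a) i * f (j + i)\<bar>)"
    by (rule summable_comparison_test'[OF s2, where N = 0])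
      (auto simp: abs_mult intro!: mult_right_mono assms)
  have "\<bar>weyl_difference a f j\<bar> \<le> (\<Sum>i. \<bar>cesaro_number (- a) i * f (j + i)\<bar>)"
    unfolding weyl_difference_def by (rule summable_rabs[OF s3])
  also have "\<dots> \<le> (\<Sum>i. M * \<bar>f (j + i)\<bar>)"
    by (rule suminf_le[OF _ s3 s2]) (auto simp: abs_mult intro!: mult_right_mono assms)
  also have "\<dots> = M * (\<Sum>i. \<bar>f (j + i)\<bar>)" by (rule suminf_mult[OF s])
  finally show ?thesis .
qed

lemma weyl_difference_diff:
  assumes "a \<ge> 0" "summable (\<lambda>n. \<bar>f n\<bar>)" "summable (\<lambda>n. \<bar>g n\<bar>)"
  shows "weyl_difference a (\<lambda>n. f n - g n) j = weyl_difference a f j - weyl_difference a g j"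
  unfolding weyl_difference_def
  using summable_rabs_cancel[OF summable_weyl_difference[OF assms(1,2), of j]]
    summable_rabs_cancel[OF summable_weyl_difference[OF assms(1,3), of j]]
  by (subst suminf_diff) (auto simp: right_diff_distrib)

text \<open>The rule \<open>D^(a+1) = D^a D^1\<close>. The identity
  \<open>k^(-a-1)(i + 1) - k^(-a)(i + 1) = - k^(-a)(i)\<close> moves the difference from the kernel
  to \<open>f\<close>.\<close>

lemma weyl_difference_plus_one:
  assumes "a \<ge> 0" "summable (\<lambda>n. \<bar>f n\<bar>)"
  shows "weyl_difference (a + 1) f j = weyl_difference a (drop_diff f) j"
proof -
  let ?k = "cesaro_number (- a)"
  have s: "summable (\<lambda>i. ?k i * f (j + i))" for j
    by (rule summable_rabs_cancel[OF summable_weyl_difference[OF assms]])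
  have s': "summable (\<lambda>i. cesaro_number (- (a + 1)) i * f (j + i))"
    by (rule summable_rabs_cancel[OF summable_weyl_difference]) (use assms in auto)
  have "weyl_difference (a + 1) f j - weyl_difference a f j =
      (\<Sum>i. (cesaro_number (- (a + 1)) i - ?k i) * f (j + i))"
    unfolding weyl_difference_def by (subst suminf_diff[OF s' s]) (simp add: left_diff_distrib)
  \<comment> \<open>The summand at 0 vanishes, because both kernels are 1 there.\<close>
  also have "\<dots> = (\<Sum>i. (cesaro_number (- (a + 1)) (Suc i) - ?k (Suc i)) * f (j + Suc i))"
    by (subst suminf_split_head)
      (use summable_diff[OF s' s] in \<open>auto simp: left_diff_distrib\<close>)
  also have "\<dots> = (\<Sum>i. - (?k i * f (Suc j + i)))"
  proof (intro arg_cong[where f = suminf] ext)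
    fix i
    have "- (a + 1) = - a - 1" by simp
    then have "cesaro_number (- (a + 1)) (Suc i) - ?k (Suc i) = - ?k i"
      using cesaro_number_diff[of "- a" i] by (simp only:)
    then show "(cesaro_number (- (a + 1)) (Suc i) - ?k (Suc i)) * f (j + Suc i) = - (?k i * f (Suc j + i))"
      by simp
  qed
  also have "\<dots> = - weyl_difference a f (Suc j)"
    unfolding weyl_difference_def by (rule suminf_minus[OF s])
  also have "weyl_difference a (drop_diff f) j = weyl_difference a f j - weyl_difference a f (Suc j)"
    unfolding weyl_difference_def drop_diff_def
    using suminf_diff[OF s[of j] s[of "Suc j"]] by (simp add: right_diff_distrib)
  ultimately show ?thesis by simp
qed

lemma summable_drop_diff:
  assumes "summable (\<lambda>n. \<bar>f n\<bar>)"
  shows "summable (\<lambda>n. \<bar>drop_diff f n\<bar>)"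
proof (rule summable_comparison_test'[where N = 0])
  show "summable (\<lambda>n. \<bar>f n\<bar> + \<bar>f (Suc n)\<bar>)"
    using assms summable_Suc_iff[of "\<lambda>n. \<bar>f n\<bar>"] by (intro summable_add) auto
qed (auto simp: drop_diff_def)

text \<open>For \<open>t < 1\<close> every kernel coefficient except the one at 0 is nonpositive,
  and \<open>f\<close> decreases. Replacing \<open>f (j + i)\<close> by \<open>f j\<close> thus only
  lowers the partial sums, which become \<open>k^(1-t)(N) f(j) \<ge> 0\<close>. Each further unit of
  order is passed on to \<open>drop_diff f\<close>.\<close>

lemma weyl_difference_nonneg:
  assumes "a \<ge> 0" "completely_monotone f" "summable (\<lambda>n. \<bar>f n\<bar>)"
  shows "0 \<le> weyl_difference a f j"
  using assms
proof (induction arbitrary: f rule: real_ge_0_induct)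
  case (base t)
  have "0 \<le> (\<Sum>i\<le>N. cesaro_number (- t) i * f (j + i))" for N
  proof -
    have "(\<Sum>i\<le>N. cesaro_number (- t) i * f j) \<le> (\<Sum>i\<le>N. cesaro_number (- t) i * f (j + i))"
    proof (rule sum_mono)
      fix i
      show "cesaro_number (- t) i * f j \<le> cesaro_number (- t) i * f (j + i)"
        using cesaro_number_minus_nonpos[of t "i - 1"] base completely_monotone_antimono[of f j "j + i"]
        by (cases i) (auto intro!: mult_left_mono_neg)
    qed
    moreover have "0 \<le> cesaro_number (- t + 1) N" "0 \<le> f j"
      using base by (auto intro: cesaro_number_nonneg completely_monotone_nonneg)
    then have "0 \<le> cesaro_number (- t + 1) N * f j" by simp
    ultimately show ?thesis by (simp add: sum_cesaro_number flip: sum_distrib_right)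
  qed
  moreover have "(\<lambda>N. \<Sum>i\<le>N. cesaro_number (- t) i * f (j + i)) \<longlonglongrightarrow> weyl_difference t f j"
    unfolding weyl_difference_def
    by (rule summable_LIMSEQ'[OF summable_rabs_cancel[OF summable_weyl_difference]]) (use base in auto)
  ultimately show ?case by (intro LIMSEQ_le_const) auto
next
  case (step t)
  then show ?case
    by (simp add: weyl_difference_plus_one completely_monotone_drop_diff summable_drop_diff)
qed

text \<open>Summation by parts of order \<open>a\<close>. The weight \<open>k^(2a+1)\<close> is the
  convolution of \<open>k^a\<close> with \<open>k^(a+1)\<close> and dominates the double series. The
  two uses are \<open>X = cesaro_sum \<alpha> T\<close>, where the inner sums are the powers of
  \<open>T\<close>, and \<open>X = k^(a+1)\<close>, where they are all 1.\<close>

lemma weyl_difference_sums: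
  fixes X :: "nat \<Rightarrow> 'b::banach"
  assumes a: "a \<ge> 0" and f: "summable (\<lambda>n. \<bar>f n\<bar> * cesaro_number (2 * a + 1) n)"
    and X: "\<And>j. norm (X j) \<le> C * cesaro_number (a + 1) j"
  obtains S where
    "(\<lambda>n. f n *\<^sub>R (\<Sum>j\<le>n. cesaro_number (- a) (n - j) *\<^sub>R X j)) sums S"
    "(\<lambda>j. weyl_difference a f j *\<^sub>R X j) sums S"
proof -
  define g where "g = (\<lambda>j i. (cesaro_number (- a) i * f (j + i)) *\<^sub>R X j)"
  have "summable (\<lambda>n. \<Sum>j\<le>n. norm (g j (n - j)))"
  proof (rule summable_comparison_test'[where N = 0])
    show "summable (\<lambda>n. C * (\<bar>f n\<bar> * cesaro_number (2 * a + 1) n))" using f by (rule summable_mult)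
    fix n :: nat
    have "(\<Sum>j\<le>n. norm (g j (n - j))) \<le>
        (\<Sum>j\<le>n. \<bar>f n\<bar> * (cesaro_number a (n - j) * (C * cesaro_number (a + 1) j)))"
    proof (rule sum_mono)
      fix j assume j: "j \<in> {..n}"
      have "\<bar>cesaro_number (- a) (n - j)\<bar> * norm (X j) \<le> cesaro_number a (n - j) * (C * cesaro_number (a + 1) j)"
        using abs_cesaro_number_le[of "- a" "n - j"] a
        by (intro mult_mono X) (auto simp: cesaro_number_nonneg)
      then show "norm (g j (n - j)) \<le> \<bar>f n\<bar> * (cesaro_number a (n - j) * (C * cesaro_number (a + 1) j))"
        using j mult_left_mono[of "\<bar>cesaro_number (- a) (n - j)\<bar> * norm (X j)"
            "cesaro_number a (n - j) * (C * cesaro_number (a + 1) j)" "\<bar>f n\<bar>"]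
        by (simp add: g_def abs_mult mult.left_commute mult.assoc)
    qed
    also have "\<dots> = C * \<bar>f n\<bar> * (\<Sum>j\<le>n. cesaro_number (a + 1) j * cesaro_number a (n - j))"
      by (simp add: sum_distrib_left mult_ac)
    also have "\<dots> = C * (\<bar>f n\<bar> * cesaro_number (2 * a + 1) n)"
      by (subst cesaro_number_convolution) (simp add: add.commute add.left_commute)
    finally show "norm (\<Sum>j\<le>n. norm (g j (n - j))) \<le> C * (\<bar>f n\<bar> * cesaro_number (2 * a + 1) n)"
      by (simp add: sum_nonneg)
  qed
  then obtain S where S: "(\<lambda>n. \<Sum>j\<le>n. g j (n - j)) sums S" "(\<lambda>j. \<Sum>i. g j i) sums S"
    by (rule triangle_sums)
  have "summable (\<lambda>n. \<bar>f n\<bar>)"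
  proof (rule summable_comparison_test'[OF f, where N = 0])
    fix n
    have "1 \<le> cesaro_number (2 * a + 1) n"
      unfolding sum_cesaro_number[symmetric]
      using a member_le_sum[of 0 "{..n}" "cesaro_number (2 * a)"] by (simp add: cesaro_number_nonneg)
    then show "norm \<bar>f n\<bar> \<le> \<bar>f n\<bar> * cesaro_number (2 * a + 1) n"
      using mult_left_mono[of 1 _ "\<bar>f n\<bar>"] by simp
  qed
  then have "summable (\<lambda>i. cesaro_number (- a) i * f (j + i))" for j
    by (rule summable_rabs_cancel[OF summable_weyl_difference[OF a]])
  then have "(\<Sum>i. g j i) = weyl_difference a f j *\<^sub>R X j" for j
    unfolding g_def weyl_difference_def by (intro suminf_scaleR_left[symmetric]) 
  with S(2) have 2: "(\<lambda>j. weyl_difference a f j *\<^sub>R X j) sums S" by simp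
  have "(\<Sum>j\<le>n. g j (n - j)) = f n *\<^sub>R (\<Sum>j\<le>n. cesaro_number (- a) (n - j) *\<^sub>R X j)" for n
    by (simp add: g_def scaleR_sum_right mult.commute)
  with S(1) have 1: "(\<lambda>n. f n *\<^sub>R (\<Sum>j\<le>n. cesaro_number (- a) (n - j) *\<^sub>R X j)) sums S" by simp
  show thesis by (rule that[OF 1 2])
qed

lemma summable_geometric_cesaro_number:
  assumes "0 \<le> r" "r < 1" "b > 0" "\<And>n. \<bar>h n\<bar> \<le> M"
  shows "summable (\<lambda>n. \<bar>h n * r ^ n\<bar> * cesaro_number b n)"
proof (rule summable_comparison_test'[where N = 0])
  show "summable (\<lambda>n. M * (cesaro_number b n * r ^ n))"
    using cesaro_number_sums[OF assms(1,2), of b] by (intro summable_mult) (simp add: sums_iff)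
  show "norm (\<bar>h n * r ^ n\<bar> * cesaro_number b n) \<le> M * (cesaro_number b n * r ^ n)" for n
    using mult_right_mono[OF assms(4)[of n], of "r ^ n * cesaro_number b n"] assms
    by (simp add: abs_mult cesaro_number_nonneg mult_ac)
qed

text \<open>Summation by parts against \<open>k^(a+1)\<close> asks for a weight that a merely
  summable \<open>f\<close> need not admit. So \<open>f\<close> is first damped by the powers of
  some \<open>\<rho> m < 1\<close>, which preserves complete monotonicity. Nonnegativity of the
  terms bounds the damped partial sums, and the bound survives the limit
  \<open>\<rho> m \<longlonglongrightarrow> 1\<close>.\<close>

lemma weyl_difference_partial_sum_le:
  assumes a: "a \<ge> 0" and f: "completely_monotone f" "summable (\<lambda>n. \<bar>f n\<bar>)"
  shows "(\<Sum>j<J. weyl_difference a f j * cesaro_number (a + 1) j) \<le> suminf f"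
proof -
  define \<rho> where "\<rho> = (\<lambda>m. real m / real (Suc m))"
  have \<rho>: "0 \<le> \<rho> m" "\<rho> m < 1" for m by (auto simp: \<rho>_def)
  have f0: "f n \<ge> 0" for n using f by (simp add: completely_monotone_nonneg)
  have sf: "summable f" using f0 f(2) by simp
  have le: "(\<Sum>j<J. weyl_difference a (\<lambda>n. f n * \<rho> m ^ n) j * cesaro_number (a + 1) j) \<le> suminf f" for m
  proof -
    let ?f = "\<lambda>n. f n * \<rho> m ^ n"
    have bd: "\<bar>f n\<bar> \<le> f 0" for n
      using f0 completely_monotone_antimono[OF f(1), of 0 n] by simp
    have lef: "?f n \<le> f n" for n
      using f0[of n] \<rho>[of m] by (intro mult_left_le) (auto simp: power_le_one)
    have sf': "summable ?f"
      by (rule summable_comparison_test'[OF sf, where N = 0]) (use lef \<rho>(1) f0 in auto)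
    have "summable (\<lambda>n. \<bar>?f n\<bar> * cesaro_number (2 * a + 1) n)"
      by (rule summable_geometric_cesaro_number[where M = "f 0"]) (use \<rho>[of m] a bd in auto)
    then obtain S where S:
      "(\<lambda>n. ?f n *\<^sub>R (\<Sum>j\<le>n. cesaro_number (- a) (n - j) *\<^sub>R cesaro_number (a + 1) j)) sums S"
      "(\<lambda>j. weyl_difference a ?f j *\<^sub>R cesaro_number (a + 1) j) sums S"
      using a by (elim weyl_difference_sums[where C = 1 and X = "cesaro_number (a + 1)", rotated])
        (auto simp: cesaro_number_nonneg)
    have "(\<Sum>j\<le>n. cesaro_number (- a) (n - j) *\<^sub>R cesaro_number (a + 1) j) = 1" for n
      using cesaro_number_convolution[where n = n and a = "a + 1" and b = "- a"] by (simp add: mult.commute)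
    with S(1) have "?f sums S" by simp
    then have "S = suminf ?f" by (simp add: sums_iff)
    also have "\<dots> \<le> suminf f" by (rule suminf_le[OF lef sf' sf])
    finally have "S \<le> suminf f" .
    have cm: "completely_monotone ?f"
      using \<rho>[of m] by (intro completely_monotone_mult f completely_monotone_power) auto
    have "(\<Sum>j<J. weyl_difference a ?f j * cesaro_number (a + 1) j) \<le> S"
    proof (rule sum_le_suminf[where I = "{..<J}", THEN order_trans])
      show "summable (\<lambda>j. weyl_difference a ?f j * cesaro_number (a + 1) j)"
        using S(2) by (simp add: sums_iff)
      show "suminf (\<lambda>j. weyl_difference a ?f j * cesaro_number (a + 1) j) \<le> S"
        using S(2) by (simp add: sums_iff)
      show "0 \<le> weyl_difference a ?f n * cesaro_number (a + 1) n" for n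
        using a sf' f0 \<rho>[of m]
        by (intro mult_nonneg_nonneg weyl_difference_nonneg cesaro_number_nonneg cm) auto
    qed auto
    with \<open>S \<le> suminf f\<close> show ?thesis by simp
  qed
  have lim: "(\<lambda>m. weyl_difference a (\<lambda>n. f n * \<rho> m ^ n) j) \<longlonglongrightarrow> weyl_difference a f j" for j
    unfolding weyl_difference_def
  proof (rule tannerys_theorem[THEN conjunct2, THEN conjunct2])
    show "summable (\<lambda>i. \<bar>cesaro_number (- a) i * f (j + i)\<bar>)"
      by (rule summable_weyl_difference[OF a f(2)])
    show "\<forall>\<^sub>F (i, m) in sequentially \<times>\<^sub>F sequentially.
        norm (cesaro_number (- a) i * (f (j + i) * \<rho> m ^ (j + i))) \<le> \<bar>cesaro_number (- a) i * f (j + i)\<bar>"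
    proof (intro always_eventually allI, clarsimp)
      fix i m
      show "\<bar>cesaro_number (- a) i * (f (j + i) * \<rho> m ^ (j + i))\<bar> \<le> \<bar>cesaro_number (- a) i * f (j + i)\<bar>"
        using \<rho>[of m] power_le_one[of "\<rho> m" "j + i"]
        by (auto simp: abs_mult intro!: mult_left_mono mult_left_le)
    qed
    have "\<rho> \<longlonglongrightarrow> 1" unfolding \<rho>_def by (rule LIMSEQ_n_over_Suc_n)
    then have "(\<lambda>m. cesaro_number (- a) i * (f (j + i) * \<rho> m ^ (j + i)))
        \<longlonglongrightarrow> cesaro_number (- a) i * (f (j + i) * 1 ^ (j + i))" for i
      by (intro tendsto_intros)
    then show "(\<lambda>m. cesaro_number (- a) i * (f (j + i) * \<rho> m ^ (j + i)))
        \<longlonglongrightarrow> cesaro_number (- a) i * f (j + i)" for i by simp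
  qed simp
  have "(\<lambda>m. \<Sum>j<J. weyl_difference a (\<lambda>n. f n * \<rho> m ^ n) j * cesaro_number (a + 1) j)
      \<longlonglongrightarrow> (\<Sum>j<J. weyl_difference a f j * cesaro_number (a + 1) j)"
    by (intro tendsto_intros lim)
  then show ?thesis using le by (intro LIMSEQ_le_const2) auto
qed

lemma weyl_difference_suminf_le:
  assumes "a \<ge> 0" "completely_monotone f" "summable (\<lambda>n. \<bar>f n\<bar>)"
  shows "summable (\<lambda>j. weyl_difference a f j * cesaro_number (a + 1) j)"
    and "(\<Sum>j. weyl_difference a f j * cesaro_number (a + 1) j) \<le> suminf f"
proof -
  have nn: "0 \<le> weyl_difference a f j * cesaro_number (a + 1) j" for j
    using assms by (intro mult_nonneg_nonneg weyl_difference_nonneg cesaro_number_nonneg) auto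
  show s: "summable (\<lambda>j. weyl_difference a f j * cesaro_number (a + 1) j)"
    by (rule summableI_nonneg_bounded[OF nn weyl_difference_partial_sum_le[OF assms]])
  show "(\<Sum>j. weyl_difference a f j * cesaro_number (a + 1) j) \<le> suminf f"
    by (rule suminf_le_const[OF s weyl_difference_partial_sum_le[OF assms]])
qed

text \<open>A hypergeometric recurrence by creative telescoping: for each \<open>i\<close> the
  combination of the two summands is \<open>g i - g (Suc i)\<close>, where \<open>g 0 = 0\<close>
  and \<open>g\<close> tends to 0.\<close>

lemma weyl_difference_cesaro_number_Suc:
  assumes "a \<ge> 0" "0 < s" "s < 1"
  defines "W \<equiv> weyl_difference a (cesaro_number (- s))"
  shows "(a + 1 + j) * W (Suc j) = (- s + j) * W j"
proof -
  let ?k = "cesaro_number (- a)" and ?f = "cesaro_number (- s)"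
  have s: "summable (\<lambda>i. ?k i * ?f (j + i))" for j
    by (rule summable_rabs_cancel[OF summable_weyl_difference])
      (use assms in \<open>auto intro: summable_abs_cesaro_number_minus\<close>)
  define g where "g = (\<lambda>i. real i * ?k i * ?f (j + i))"
  have telescope: "(a + 1 + j) * (?k i * ?f (Suc j + i)) - (- s + j) * (?k i * ?f (j + i)) = g i - g (Suc i)" for i
  proof -
    have f: "(real i + real j + 1) * ?f (Suc j + i) = ?f (j + i) * (- s + (j + i))"
      by (simp add: cesaro_number_Suc add_ac)
    have k: "real (Suc i) * ?k (Suc i) = ?k i * (- a + i)"
      by (simp add: cesaro_number_Suc)
    have "g i - g (Suc i) = real i * ?k i * ?f (j + i) - ?k i * (- a + i) * ?f (Suc j + i)"
      by (simp only: g_def k add_Suc add_Suc_right)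
    moreover have "(a + 1 + j) * (?k i * ?f (Suc j + i)) - (- s + j) * (?k i * ?f (j + i)) -
        (real i * ?k i * ?f (j + i) - ?k i * (- a + i) * ?f (Suc j + i)) =
        ?k i * ((real i + real j + 1) * ?f (Suc j + i) - ?f (j + i) * (- s + (j + i)))"
      by (simp add: algebra_simps)
    ultimately show ?thesis by (simp only: f) simp
  qed
  \<comment> \<open>Here \<open>n k^(-s)(n) = - s k^(1-s)(n - 1)\<close> tends to 0, and the
    remaining factor \<open>k^(-a)(i)\<close> is bounded.\<close>
  have "g \<longlonglongrightarrow> 0"
  proof -
    obtain M where M: "M > 0" "\<And>n. \<bar>?k n\<bar> \<le> M"
      using cesaro_number_minus_bounded[OF assms(1)] by auto
    have "(\<lambda>n. \<bar>real (Suc n) * ?f (Suc n)\<bar>) \<longlonglongrightarrow> 0"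
    proof -
      have "(\<lambda>n. cesaro_number (1 - s) n) \<longlonglongrightarrow> 0"
        using cesaro_number_minus_sums[of s] assms by (simp add: sums_def_le sum_cesaro_number)
      then have "(\<lambda>n. \<bar>- s * cesaro_number (1 - s) n\<bar>) \<longlonglongrightarrow> \<bar>- s * 0\<bar>"
        by (intro tendsto_intros)
      then show ?thesis by (simp add: cesaro_number_minus_Suc)
    qed
    then have "(\<lambda>n. \<bar>real n * ?f n\<bar>) \<longlonglongrightarrow> 0" by (rule LIMSEQ_imp_Suc)
    then have "(\<lambda>i. \<bar>real (i + j) * ?f (i + j)\<bar>) \<longlonglongrightarrow> 0" by (rule LIMSEQ_ignore_initial_segment)
    then have lim: "(\<lambda>i. M * \<bar>real (i + j) * ?f (i + j)\<bar>) \<longlonglongrightarrow> 0" by (rule tendsto_mult_right_zero)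
    have "norm (g i) \<le> M * \<bar>real (i + j) * ?f (i + j)\<bar>" for i
    proof -
      have "norm (g i) = \<bar>?k i\<bar> * (real i * \<bar>?f (i + j)\<bar>)" by (simp add: g_def abs_mult add.commute)
      also have "\<dots> \<le> M * (real (i + j) * \<bar>?f (i + j)\<bar>)"
        using M by (intro mult_mono) auto
      finally show ?thesis by (simp add: abs_mult)
    qed
    then show ?thesis by (intro Lim_null_comparison[OF _ lim]) auto
  qed
  then have "(\<lambda>i. g i - g (Suc i)) sums (g 0 - 0)" by (rule telescope_sums')
  then have "(\<lambda>i. (a + 1 + j) * (?k i * ?f (Suc j + i)) - (- s + j) * (?k i * ?f (j + i))) sums 0"
    unfolding telescope by (simp add: g_def)
  moreover have "(\<lambda>i. (a + 1 + j) * (?k i * ?f (Suc j + i)) - (- s + j) * (?k i * ?f (j + i))) sums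
      ((a + 1 + j) * W (Suc j) - (- s + j) * W j)"
    unfolding W_def weyl_difference_def
    by (intro sums_diff sums_mult summable_sums s)
  ultimately show ?thesis using sums_unique2 by fastforce
qed

text \<open>Both sides obey the same recurrence in \<open>j\<close>. Hence the Weyl coefficient
  times the growth bound of the Cesaro sum is a multiple of the absolutely summable
  \<open>k^(-s)(j)\<close>.\<close>

lemma weyl_difference_cesaro_number:
  assumes "a \<ge> 0" "0 < s" "s < 1"
  defines "W \<equiv> weyl_difference a (cesaro_number (- s))"
  shows "W j * cesaro_number (a + 1) j = W 0 * cesaro_number (- s) j"
proof (induction j)
  case (Suc j)
  have "W (Suc j) * cesaro_number (a + 1) (Suc j) =
      ((a + 1 + j) * W (Suc j)) * cesaro_number (a + 1) j / Suc j"
    by (simp add: cesaro_number_Suc mult_ac)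
  also have "\<dots> = (- s + j) * (W j * cesaro_number (a + 1) j) / Suc j"
    unfolding W_def weyl_difference_cesaro_number_Suc[OF assms(1-3)] by (simp add: mult_ac)
  also have "\<dots> = W 0 * cesaro_number (- s) (Suc j)"
    by (simp add: Suc cesaro_number_Suc mult_ac)
  finally show ?case .
qed simp

text \<open>Expand \<open>(1 - t)^s\<close> in the Beta integral and integrate termwise. The
  coefficients after the first are nonpositive, so the negated partial sums increase and monotone
  convergence applies.\<close>

lemma Beta_sums:
  fixes a s :: real
  assumes "a > 0" "0 < s" "s < 1"
  shows "(\<lambda>j. cesaro_number (- s) j / (a + j)) sums Beta a (1 + s)"
proof -
  let ?f = "cesaro_number (- s)"
  have sm: "summable (\<lambda>j. ?f j / (a + j))"
  proof (rule summable_comparison_test'[where N = 0])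
    show "summable (\<lambda>j. \<bar>?f j\<bar> * (1 / a))"
      using summable_abs_cesaro_number_minus[of s] assms by (intro summable_mult2) auto
    show "norm (?f j / (a + j)) \<le> \<bar>?f j\<bar> * (1 / a)" for j
      using assms by (simp add: frac_le)
  qed
  have int: "((\<lambda>t. - (t powr (a - 1) * (1 - t) powr s)) has_integral - (\<Sum>j. ?f j / (a + j))) {0<..<1}"
  proof (rule has_integral_monotone_convergence_increasing)
    show "((\<lambda>t. - (\<Sum>j\<le>N. ?f j * t powr (a + j - 1))) has_integral - (\<Sum>j\<le>N. ?f j / (a + j))) {0<..<1}" for N
    proof (intro has_integral_neg has_integral_sum)
      fix j :: nat
      have "((\<lambda>t. t powr (a + j - 1)) has_integral 1 powr (a + j - 1 + 1) / (a + j - 1 + 1)) {0..1}"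
        using assms by (intro has_integral_powr_from_0) auto
      then have "((\<lambda>t. t powr (a + j - 1)) has_integral 1 / (a + j)) {0<..<1}"
        by (simp add: has_integral_Icc_iff_Ioo)
      then show "((\<lambda>t. ?f j * t powr (a + j - 1)) has_integral ?f j / (a + j)) {0<..<1}"
        using has_integral_mult_right[of _ "1 / (a + j)" _ "?f j"] by simp
    qed auto
    show "- (\<Sum>j\<le>N. ?f j * t powr (a + j - 1)) \<le> - (\<Sum>j\<le>Suc N. ?f j * t powr (a + j - 1))" for N t
      using assms cesaro_number_minus_nonpos[of s N] by (simp add: mult_nonpos_nonneg)
    show "(\<lambda>N. - (\<Sum>j\<le>N. ?f j * t powr (a + j - 1))) \<longlonglongrightarrow> - (t powr (a - 1) * (1 - t) powr s)"
      if "t \<in> {0<..<1}" for t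
    proof (rule tendsto_minus)
      have "(\<lambda>j. t powr (a - 1) * (?f j * t ^ j)) sums (t powr (a - 1) * (1 - t) powr s)"
        using cesaro_number_sums[of t "- s"] that by (intro sums_mult) auto
      moreover have "t powr (a - 1) * (?f j * t ^ j) = ?f j * t powr (a + j - 1)" for j
        using that by (simp add: powr_add[symmetric] powr_realpow[symmetric] algebra_simps)
      ultimately show "(\<lambda>N. \<Sum>j\<le>N. ?f j * t powr (a + j - 1)) \<longlonglongrightarrow> t powr (a - 1) * (1 - t) powr s"
        by (simp add: sums_def_le)
    qed
    show "(\<lambda>N. - (\<Sum>j\<le>N. ?f j / (a + j))) \<longlonglongrightarrow> - (\<Sum>j. ?f j / (a + j))"
      by (intro tendsto_minus summable_LIMSEQ' sm)
  qed
  have "((\<lambda>t. t powr (a - 1) * (1 - t) powr s) has_integral (\<Sum>j. ?f j / (a + j))) {0..1}"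
    using has_integral_neg[OF int] by (simp add: has_integral_Icc_iff_Ioo)
  moreover have "((\<lambda>t. t powr (a - 1) * (1 - t) powr s) has_integral Beta a (1 + s)) {0..1}"
    using has_integral_Beta_real[of a "1 + s"] assms by simp
  ultimately have "(\<Sum>j. ?f j / (a + j)) = Beta a (1 + s)" by (rule has_integral_unique)
  with sm show ?thesis by (simp add: sums_iff)
qed

section \<open>Cesaro bounded operators\<close>

interpretation blinfun_compose: bounded_bilinear "(o\<^sub>L)"
  by (rule bounded_bilinear_blinfun_compose)

lemma blinfun_compose_assoc: "(A o\<^sub>L B) o\<^sub>L D = A o\<^sub>L (B o\<^sub>L D)"
  by (rule blinfun_eqI) simp

lemma blinfun_compose_id [simp]: "A o\<^sub>L id_blinfun = A" "id_blinfun o\<^sub>L A = A"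
  by (auto intro!: blinfun_eqI)

lemma blinfun_power_add: "blinfun_power T (m + n) = blinfun_power T m o\<^sub>L blinfun_power T n"
  by (induction m) (simp_all add: blinfun_compose_assoc)

lemma blinfun_power_Suc_right: "blinfun_power T (Suc n) = blinfun_power T n o\<^sub>L T"
  using blinfun_power_add[of T n 1] by simp

lemma cesaro_sum_0 [simp]: "cesaro_sum a T 0 = id_blinfun"
  by (simp add: cesaro_sum_def)

lemma cesaro_sum_compose:
  "cesaro_sum a T n o\<^sub>L T = cesaro_sum a T (Suc n) - cesaro_number a (Suc n) *\<^sub>R id_blinfun"
proof -
  have "cesaro_sum a T (Suc n) = cesaro_number a (Suc n) *\<^sub>R id_blinfun +
      (\<Sum>i\<le>n. cesaro_number a (n - i) *\<^sub>R blinfun_power T (Suc i))"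
    unfolding cesaro_sum_def by (subst sum.atMost_Suc_shift) simp
  then show ?thesis
    by (simp add: cesaro_sum_def blinfun_compose.sum_left blinfun_compose.scaleR_left
        flip: blinfun_power_Suc_right del: blinfun_power.simps(2))
qed

lemma cesaro_sum_diff_compose:
  "cesaro_sum a T n o\<^sub>L (id_blinfun - T) =
     cesaro_number a (Suc n) *\<^sub>R id_blinfun - cesaro_sum a T (Suc n) + cesaro_sum a T n"
  by (simp add: blinfun_compose.diff_right cesaro_sum_compose)

text \<open>With \<open>b = - a\<close> this inverts the Cesaro summation and recovers the powers of
  \<open>T\<close> from the sums that the hypothesis bounds.\<close>

lemma cesaro_sum_convolution:
  "(\<Sum>j\<le>n. cesaro_number b (n - j) *\<^sub>R cesaro_sum a T j) = cesaro_sum (a + b) T n"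
proof -
  have "(\<Sum>j\<le>n. cesaro_number b (n - j) *\<^sub>R cesaro_sum a T j) =
      (\<Sum>(j, i)\<in>(SIGMA j:{..n}. {..j}).
        (cesaro_number b (n - j) * cesaro_number a (j - i)) *\<^sub>R blinfun_power T i)"
    by (simp add: cesaro_sum_def scaleR_sum_right sum.Sigma)
  also have "\<dots> = (\<Sum>(i, m)\<in>(SIGMA i:{..n}. {..n - i}).
        (cesaro_number b (n - i - m) * cesaro_number a m) *\<^sub>R blinfun_power T i)"
    by (rule sum.reindex_bij_witness[where j = "\<lambda>(j, i). (i, j - i)" and i = "\<lambda>(i, m). (i + m, i)"])
      auto
  also have "\<dots> = (\<Sum>i\<le>n. (\<Sum>m\<le>n - i. cesaro_number a m * cesaro_number b (n - i - m)) *\<^sub>R blinfun_power T i)"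
    by (simp add: scaleR_sum_left mult.commute sum.Sigma)
  also have "\<dots> = cesaro_sum (a + b) T n"
    unfolding cesaro_sum_def by (simp only: cesaro_number_convolution)
  finally show ?thesis .
qed

lemma cesaro_sum_zero: "cesaro_sum 0 T n = blinfun_power T n"
proof -
  have "cesaro_sum 0 T n = (\<Sum>j\<le>n. (if j = n then blinfun_power T j else 0))"
    unfolding cesaro_sum_def by (intro sum.cong) auto
  then show ?thesis by simp
qed

lemma blinfun_power_eq_cesaro_sum:
  "blinfun_power T n = (\<Sum>j\<le>n. cesaro_number (- a) (n - j) *\<^sub>R cesaro_sum a T j)"
  by (simp add: cesaro_sum_convolution cesaro_sum_zero)

text \<open>For \<open>0 \<le> r < 1\<close> and \<open>T\<close> of spectral radius at most 1, this is \<open>(I - rT)\<^sup>-\<^sup>b\<close>.\<close>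

definition abel_power :: "('a::banach \<Rightarrow>\<^sub>L 'a) \<Rightarrow> real \<Rightarrow> real \<Rightarrow> ('a \<Rightarrow>\<^sub>L 'a)" where
  "abel_power T b r = (\<Sum>n. (cesaro_number b n * r ^ n) *\<^sub>R blinfun_power T n)"

lemma abel_power_0: "abel_power T 0 r = id_blinfun"
  using suminf_finite[of "{0}" "\<lambda>n. (cesaro_number 0 n * r ^ n) *\<^sub>R blinfun_power T n"]
  by (simp add: abel_power_def)

lemma abel_power_minus_one: "abel_power T (- 1) r = id_blinfun - r *\<^sub>R T"
  using suminf_finite[of "{0, 1}" "\<lambda>n. (cesaro_number (- 1) n * r ^ n) *\<^sub>R blinfun_power T n"]
  by (simp add: abel_power_def cesaro_number_minus_one)

text \<open>The constant is explicit and the space only a real Banach space, so that the zero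
  operator on the real line is an instance as well. Complex scalars enter with weak
  convergence.\<close>

locale cesaro_bounded_operator =
  fixes T :: "'a::banach \<Rightarrow>\<^sub>L 'a" and \<alpha> C :: real
  assumes alpha: "\<alpha> \<ge> 0"
    and norm_cesaro_sum: "norm (cesaro_sum \<alpha> T n) \<le> C * cesaro_number (\<alpha> + 1) n"
begin

lemma C_nonneg: "C \<ge> 0"
  using order_trans[OF norm_ge_zero norm_cesaro_sum[of 0]] by simp

text \<open>Polynomial growth of the powers makes every power series in \<open>r T\<close> with
  bounded coefficients converge for \<open>0 \<le> r < 1\<close>.\<close>

lemma norm_blinfun_power: "norm (blinfun_power T n) \<le> C * cesaro_number (2 * \<alpha> + 1) n"
proof -
  have "norm (blinfun_power T n) \<le> (\<Sum>j\<le>n. norm (cesaro_number (- \<alpha>) (n - j) *\<^sub>R cesaro_sum \<alpha> T j))"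
    unfolding blinfun_power_eq_cesaro_sum[of T n \<alpha>] by (rule norm_sum)
  also have "\<dots> \<le> (\<Sum>j\<le>n. cesaro_number \<alpha> (n - j) * (C * cesaro_number (\<alpha> + 1) j))"
    unfolding norm_scaleR using alpha abs_cesaro_number_le[of "- \<alpha>"]
    by (intro sum_mono mult_mono norm_cesaro_sum) (auto simp: cesaro_number_nonneg)
  also have "\<dots> = C * (\<Sum>j\<le>n. cesaro_number (\<alpha> + 1) j * cesaro_number \<alpha> (n - j))"
    by (simp add: sum_distrib_left mult_ac)
  also have "\<dots> = C * cesaro_number (2 * \<alpha> + 1) n"
    by (subst cesaro_number_convolution) (simp add: add.commute add.left_commute)
  finally show ?thesis .
qed

lemma summable_power_series:
  assumes "0 \<le> r" "r < 1" "\<And>n. \<bar>h n\<bar> \<le> M"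
  shows "summable (\<lambda>n. norm ((h n * r ^ n) *\<^sub>R blinfun_power T n))"
proof (rule summable_comparison_test'[where N = 0])
  show "summable (\<lambda>n. C * (\<bar>h n * r ^ n\<bar> * cesaro_number (2 * \<alpha> + 1) n))"
    using summable_geometric_cesaro_number[OF assms(1,2) _ assms(3)] alpha by (intro summable_mult) auto
  show "norm (norm ((h n * r ^ n) *\<^sub>R blinfun_power T n)) \<le> C * (\<bar>h n * r ^ n\<bar> * cesaro_number (2 * \<alpha> + 1) n)" for n
    using mult_left_mono[OF norm_blinfun_power[of n], of "\<bar>h n * r ^ n\<bar>"] by (simp add: mult_ac)
qed

lemma abel_power_sums:
  assumes "0 \<le> r" "r < 1" "\<bar>b\<bar> \<le> 1"
  shows "(\<lambda>n. (cesaro_number b n * r ^ n) *\<^sub>R blinfun_power T n) sums abel_power T b r"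
  unfolding abel_power_def
  by (rule summable_sums[OF summable_norm_cancel[OF summable_power_series[OF assms(1,2)
          abs_cesaro_number_le_1[OF assms(3)]]]])

lemma abel_power_weyl_sums:
  assumes "0 \<le> r" "r < 1" "\<bar>b\<bar> \<le> 1"
  shows "(\<lambda>j. weyl_difference \<alpha> (\<lambda>n. cesaro_number b n * r ^ n) j *\<^sub>R cesaro_sum \<alpha> T j) sums abel_power T b r"
proof -
  have "summable (\<lambda>n. \<bar>cesaro_number b n * r ^ n\<bar> * cesaro_number (2 * \<alpha> + 1) n)"
    using alpha by (intro summable_geometric_cesaro_number[OF assms(1,2) _ abs_cesaro_number_le_1[OF assms(3)]]) auto
  then obtain S where S:
    "(\<lambda>n. (cesaro_number b n * r ^ n) *\<^sub>R (\<Sum>j\<le>n. cesaro_number (- \<alpha>) (n - j) *\<^sub>R cesaro_sum \<alpha> T j)) sums S"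
    "(\<lambda>j. weyl_difference \<alpha> (\<lambda>n. cesaro_number b n * r ^ n) j *\<^sub>R cesaro_sum \<alpha> T j) sums S"
    by (rule weyl_difference_sums[OF alpha _ norm_cesaro_sum])
  have "S = abel_power T b r"
    using S(1) abel_power_sums[OF assms] unfolding blinfun_power_eq_cesaro_sum[symmetric]
    by (rule sums_unique2)
  with S(2) show ?thesis by simp
qed

text \<open>The positivity principle for \<open>k^b(n) r^n\<close>, a product of two completely
  monotone sequences, with sum \<open>(1 - r)^(-b)\<close>.\<close>

lemma norm_abel_power_le:
  assumes "0 \<le> r" "r < 1" "0 < b" "b \<le> 1"
  shows "norm (abel_power T b r) \<le> C * (1 - r) powr (- b)"
proof -
  let ?f = "\<lambda>n. cesaro_number b n * r ^ n"
  let ?W = "weyl_difference \<alpha> ?f"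
  have cm: "completely_monotone ?f"
    using assms by (intro completely_monotone_mult completely_monotone_cesaro_number completely_monotone_power) auto
  have f: "?f sums (1 - r) powr (- b)" by (rule cesaro_number_sums[OF assms(1,2)])
  have sm: "summable (\<lambda>n. \<bar>?f n\<bar>)"
    using completely_monotone_nonneg[OF cm] f by (simp add: sums_iff)
  have W: "?W j \<ge> 0" for j by (rule weyl_difference_nonneg[OF alpha cm sm])
  have sW: "summable (\<lambda>j. C * (?W j * cesaro_number (\<alpha> + 1) j))"
    by (intro summable_mult weyl_difference_suminf_le alpha cm sm)
  have le: "norm (?W j *\<^sub>R cesaro_sum \<alpha> T j) \<le> C * (?W j * cesaro_number (\<alpha> + 1) j)" for j
    using mult_left_mono[OF norm_cesaro_sum[of j] W[of j]] W[of j] by (simp add: mult_ac)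
  have "norm (abel_power T b r) \<le> (\<Sum>j. C * (?W j * cesaro_number (\<alpha> + 1) j))"
    using norm_suminf_le[OF le sW] abel_power_weyl_sums[of r b] assms by (simp add: sums_iff)
  also have "\<dots> = C * (\<Sum>j. ?W j * cesaro_number (\<alpha> + 1) j)"
    by (intro suminf_mult weyl_difference_suminf_le alpha cm sm)
  also have "\<dots> \<le> C * (1 - r) powr (- b)"
    using weyl_difference_suminf_le(2)[OF alpha cm sm] C_nonneg f by (intro mult_left_mono) (simp_all add: sums_iff)
  finally show ?thesis .
qed

lemma abel_power_compose:
  assumes r: "0 \<le> r" "r < 1" and b: "\<bar>b\<bar> \<le> 1" "\<bar>c\<bar> \<le> 1"
  shows "abel_power T b r o\<^sub>L abel_power T c r = abel_power T (b + c) r"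
proof -
  define g where "g = (\<lambda>i j. (cesaro_number b i * r ^ i) *\<^sub>R blinfun_power T i o\<^sub>L
      (cesaro_number c j * r ^ j) *\<^sub>R blinfun_power T j)"
  have g: "g i j = ((cesaro_number b i * cesaro_number c j) * r ^ (i + j)) *\<^sub>R blinfun_power T (i + j)" for i j
    by (simp add: g_def blinfun_compose.scaleR_left blinfun_compose.scaleR_right blinfun_power_add power_add mult_ac)
  have tri: "(\<Sum>i\<le>n. g i (n - i)) = (cesaro_number (b + c) n * r ^ n) *\<^sub>R blinfun_power T n" for n
    by (simp add: g cesaro_number_convolution flip: scaleR_sum_left sum_distrib_right)
  have "summable (\<lambda>n. \<Sum>i\<le>n. norm (g i (n - i)))"
  proof (rule summable_comparison_test'[where N = 0])
    show "summable (\<lambda>n. C * (2 * \<alpha> + 1) * (cesaro_number (2 * \<alpha> + 1 + 1) n * r ^ n))"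
      using cesaro_number_sums[OF r] by (intro summable_mult) (auto simp: sums_iff)
    fix n :: nat
    have "(\<Sum>i\<le>n. norm (g i (n - i))) \<le> (\<Sum>i\<le>n. r ^ n * (C * cesaro_number (2 * \<alpha> + 1) n))"
    proof (rule sum_mono)
      fix i assume "i \<in> {..n}"
      then have "norm (g i (n - i)) = (\<bar>cesaro_number b i\<bar> * \<bar>cesaro_number c (n - i)\<bar>) * (r ^ n * norm (blinfun_power T n))"
        using r by (simp add: g abs_mult)
      also have "\<dots> \<le> (1 * 1) * (r ^ n * (C * cesaro_number (2 * \<alpha> + 1) n))"
        using r b norm_blinfun_power[of n]
        by (intro mult_mono abs_cesaro_number_le_1) (auto simp: abs_cesaro_number_le_1 mult_le_one)
      finally show "norm (g i (n - i)) \<le> r ^ n * (C * cesaro_number (2 * \<alpha> + 1) n)" by simp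
    qed
    \<comment> \<open>The coefficients are at most 1 in absolute value, so a diagonal costs a factor
      \<open>n + 1\<close>. Raising the order of the Cesaro number by one absorbs it.\<close>
    also have "\<dots> = C * r ^ n * (real (Suc n) * cesaro_number (2 * \<alpha> + 1) n)"
      by (simp add: mult_ac)
    also have "\<dots> \<le> C * r ^ n * ((2 * \<alpha> + 1) * cesaro_number (2 * \<alpha> + 1 + 1) n)"
      using r C_nonneg alpha by (intro mult_left_mono Suc_times_cesaro_number_le) auto
    finally show "norm (\<Sum>i\<le>n. norm (g i (n - i))) \<le> C * (2 * \<alpha> + 1) * (cesaro_number (2 * \<alpha> + 1 + 1) n * r ^ n)"
      by (simp add: sum_nonneg mult_ac)
  qed
  then obtain S where S: "(\<lambda>n. \<Sum>i\<le>n. g i (n - i)) sums S" "(\<lambda>i. \<Sum>j. g i j) sums S"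
    by (rule triangle_sums)
  have "S = abel_power T (b + c) r"
    using S(1) unfolding tri abel_power_def by (simp add: sums_iff)
  moreover have "(\<Sum>j. g i j) = (cesaro_number b i * r ^ i) *\<^sub>R blinfun_power T i o\<^sub>L abel_power T c r" for i
    unfolding g_def
    by (rule sums_unique[symmetric])
      (rule blinfun_compose.bounded_linear_right[THEN bounded_linear.sums, OF abel_power_sums[OF r b(2)]])
  with S(2) have "(\<lambda>i. (cesaro_number b i * r ^ i) *\<^sub>R blinfun_power T i o\<^sub>L abel_power T c r) sums S" by simp
  then have "S = abel_power T b r o\<^sub>L abel_power T c r"
    by (rule sums_unique2)
      (rule blinfun_compose.bounded_linear_left[THEN bounded_linear.sums, OF abel_power_sums[OF r b(1)]])
  ultimately show ?thesis by simp
qed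

text \<open>The closed form of the Weyl coefficients cancels the growth of the Cesaro sums. The
  resulting majorant is kept as a second claim because it also bounds the tails of the
  series.\<close>

lemma frac_power_sums:
  assumes "0 < s" "s < 1"
  shows "(\<lambda>j. weyl_difference \<alpha> (cesaro_number (- s)) j *\<^sub>R cesaro_sum \<alpha> T j) sums frac_power \<alpha> s T"
    and "norm (weyl_difference \<alpha> (cesaro_number (- s)) j *\<^sub>R cesaro_sum \<alpha> T j) \<le>
      C * \<bar>weyl_difference \<alpha> (cesaro_number (- s)) 0\<bar> * \<bar>cesaro_number (- s) j\<bar>"
proof -
  let ?W = "weyl_difference \<alpha> (cesaro_number (- s))"
  show le: "norm (?W j *\<^sub>R cesaro_sum \<alpha> T j) \<le> C * \<bar>?W 0\<bar> * \<bar>cesaro_number (- s) j\<bar>" for j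
  proof -
    have "norm (?W j *\<^sub>R cesaro_sum \<alpha> T j) \<le> \<bar>?W j\<bar> * (C * cesaro_number (\<alpha> + 1) j)"
      unfolding norm_scaleR by (intro mult_left_mono norm_cesaro_sum) auto
    also have "\<dots> = C * \<bar>?W j * cesaro_number (\<alpha> + 1) j\<bar>"
      using alpha by (simp add: abs_mult cesaro_number_nonneg)
    also have "\<dots> = C * \<bar>?W 0\<bar> * \<bar>cesaro_number (- s) j\<bar>"
      unfolding weyl_difference_cesaro_number[OF alpha assms] by (simp add: abs_mult)
    finally show ?thesis .
  qed
  have "summable (\<lambda>j. ?W j *\<^sub>R cesaro_sum \<alpha> T j)"
  proof (rule summable_comparison_test'[OF _ le])
    show "summable (\<lambda>j. C * \<bar>?W 0\<bar> * \<bar>cesaro_number (- s) j\<bar>)"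
      using assms by (intro summable_mult summable_abs_cesaro_number_minus) auto
  qed
  then show "(\<lambda>j. ?W j *\<^sub>R cesaro_sum \<alpha> T j) sums frac_power \<alpha> s T"
    unfolding frac_power_def by (rule summable_sums)
qed

text \<open>The coefficients of the difference, \<open>f(n) = k^(-s)(n) (1 - r^n)\<close>, vanish at
  0 and are nonpositive afterwards, so neither \<open>f\<close> nor \<open>- f\<close> is completely
  monotone. The shifted sequence \<open>- f(n + 1)\<close> is, and its sum is
  \<open>(1 - r)^s\<close>.\<close>

lemma frac_power_approx:
  assumes s: "0 < s" "s < 1"
  shows "\<exists>K\<ge>0. \<forall>r. 0 \<le> r \<and> r < 1 \<longrightarrow> norm (frac_power \<alpha> s T - abel_power T (- s) r) \<le> K * (1 - r) powr s"
proof -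
  obtain M where M: "M > 0" "\<And>n. \<bar>cesaro_number (- \<alpha>) n\<bar> \<le> M"
    using cesaro_number_minus_bounded[OF alpha] by auto
  have "norm (frac_power \<alpha> s T - abel_power T (- s) r) \<le> (M * C + C * (\<alpha> + 1)) * (1 - r) powr s"
    if r: "0 \<le> r" "r < 1" for r
  proof -
    let ?k = "cesaro_number (- s)" and ?S = "cesaro_sum \<alpha> T"
    define f where "f = (\<lambda>n. ?k n - ?k n * r ^ n)"
    define h where "h = (\<lambda>n. - f (Suc n))"
    have "h = (\<lambda>n. s * (cesaro_number (1 - s) n * ((1 - r ^ Suc n) / Suc n)))"
      by (simp add: h_def f_def cesaro_number_minus_Suc diff_divide_distrib right_diff_distrib fun_eq_iff)
    then have cm: "completely_monotone h"
      using s r by (simp only:) (intro completely_monotone_scale completely_monotone_mult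
          completely_monotone_cesaro_number completely_monotone_power_integral, auto)
    have "f sums (0 - (1 - r) powr s)"
      unfolding f_def using cesaro_number_sums[OF r, of "- s"] cesaro_number_minus_sums[OF s]
      by (intro sums_diff) auto
    then have "(\<lambda>n. f (Suc n)) sums (- ((1 - r) powr s))"
      using sums_Suc_iff[of f] by (simp add: f_def)
    then have hs: "h sums (1 - r) powr s"
      unfolding h_def using sums_minus by fastforce
    have abs_f: "\<bar>f (Suc n)\<bar> = h n" for n
      using completely_monotone_nonneg[OF cm, of n] by (simp add: h_def)
    have "(\<lambda>n. \<bar>f (Suc n)\<bar>) sums (1 - r) powr s" using hs by (simp add: abs_f)
    then have fs: "(\<lambda>n. \<bar>f n\<bar>) sums (1 - r) powr s"
      by (subst (asm) sums_Suc_iff) (simp add: f_def)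
    have sm_f: "summable (\<lambda>n. \<bar>f n\<bar>)" using fs by (simp add: sums_iff)
    have sm_h: "summable (\<lambda>n. \<bar>h n\<bar>)"
      using hs completely_monotone_nonneg[OF cm] by (simp add: sums_iff)
    define d where "d = weyl_difference \<alpha> f"
    \<comment> \<open>The shift leaves out the Weyl coefficient at 0, which is estimated directly by
      the sum of the absolute values of \<open>f\<close>.\<close>
    have d0: "\<bar>d 0\<bar> \<le> M * (1 - r) powr s"
      using abs_weyl_difference_le[OF M(2) sm_f, of 0] fs by (simp add: d_def sums_iff)
    have dSuc: "d (Suc j) = - weyl_difference \<alpha> h j" for j
    proof -
      have "weyl_difference \<alpha> h j = (\<Sum>i. - (cesaro_number (- \<alpha>) i * f (Suc j + i)))"
        by (simp add: weyl_difference_def h_def)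
      also have "\<dots> = - d (Suc j)"
        unfolding d_def weyl_difference_def
        by (rule suminf_minus[OF summable_rabs_cancel[OF summable_weyl_difference[OF alpha sm_f]]])
      finally show ?thesis by simp
    qed
    have "summable (\<lambda>n. \<bar>?k n * r ^ n\<bar>)"
    proof (rule summable_comparison_test'[where N = 0])
      show "summable (\<lambda>n. r ^ n)" using r by (simp add: summable_geometric)
      show "norm \<bar>?k n * r ^ n\<bar> \<le> r ^ n" for n
        using mult_right_mono[OF abs_cesaro_number_le_1[of "- s" n], of "r ^ n"] s r
        by (simp add: abs_mult)
    qed
    then have d_eq: "d j = weyl_difference \<alpha> ?k j - weyl_difference \<alpha> (\<lambda>n. ?k n * r ^ n) j" for j
      unfolding d_def f_def using s
      by (intro weyl_difference_diff alpha summable_abs_cesaro_number_minus) auto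
    have "(\<lambda>j. d j *\<^sub>R ?S j) sums (frac_power \<alpha> s T - abel_power T (- s) r)"
      unfolding d_eq scaleR_left_diff_distrib using s r
      by (intro sums_diff frac_power_sums abel_power_weyl_sums) auto
    then have tail: "(\<lambda>j. d (Suc j) *\<^sub>R ?S (Suc j)) sums (frac_power \<alpha> s T - abel_power T (- s) r - d 0 *\<^sub>R id_blinfun)"
      by (subst sums_Suc_iff) simp
    have Wh: "weyl_difference \<alpha> h j \<ge> 0" for j by (rule weyl_difference_nonneg[OF alpha cm sm_h])
    \<comment> \<open>The index of \<open>h\<close> lags by one behind that of the Cesaro sum;
      comparing \<open>k^(\<alpha>+1)(j + 1)\<close> with \<open>k^(\<alpha>+1)(j)\<close> costs the
      factor \<open>\<alpha> + 1\<close>.\<close>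
    have le: "norm (d (Suc j) *\<^sub>R ?S (Suc j)) \<le> C * (\<alpha> + 1) * (weyl_difference \<alpha> h j * cesaro_number (\<alpha> + 1) j)" for j
    proof -
      have "norm (?S (Suc j)) \<le> C * ((\<alpha> + 1) * cesaro_number (\<alpha> + 1) j)"
        using norm_cesaro_sum[of "Suc j"] mult_left_mono[OF cesaro_number_Suc_le[OF alpha, of j] C_nonneg] by simp
      then have "weyl_difference \<alpha> h j * norm (?S (Suc j)) \<le> weyl_difference \<alpha> h j * (C * ((\<alpha> + 1) * cesaro_number (\<alpha> + 1) j))"
        using Wh by (rule mult_left_mono)
      then show ?thesis using Wh[of j] by (simp add: dSuc mult_ac)
    qed
    have "norm (frac_power \<alpha> s T - abel_power T (- s) r - d 0 *\<^sub>R id_blinfun) \<le>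
        (\<Sum>j. C * (\<alpha> + 1) * (weyl_difference \<alpha> h j * cesaro_number (\<alpha> + 1) j))"
      unfolding sums_unique[OF tail]
      by (rule norm_suminf_le[OF le summable_mult[OF weyl_difference_suminf_le(1)[OF alpha cm sm_h]]])
    also have "\<dots> = C * (\<alpha> + 1) * (\<Sum>j. weyl_difference \<alpha> h j * cesaro_number (\<alpha> + 1) j)"
      by (intro suminf_mult weyl_difference_suminf_le(1)[OF alpha cm sm_h])
    also have "\<dots> \<le> C * (\<alpha> + 1) * (1 - r) powr s"
      using weyl_difference_suminf_le(2)[OF alpha cm sm_h] hs C_nonneg alpha
      by (intro mult_left_mono) (auto simp: sums_iff)
    finally have 1: "norm (frac_power \<alpha> s T - abel_power T (- s) r - d 0 *\<^sub>R id_blinfun) \<le> C * (\<alpha> + 1) * (1 - r) powr s" .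
    have "norm (id_blinfun :: 'a \<Rightarrow>\<^sub>L 'a) \<le> C" using norm_cesaro_sum[of 0] by simp
    then have "norm (d 0 *\<^sub>R (id_blinfun :: 'a \<Rightarrow>\<^sub>L 'a)) \<le> M * (1 - r) powr s * C"
      unfolding norm_scaleR using M by (intro mult_mono d0) auto
    with 1 show ?thesis
      using norm_triangle_ineq[of "frac_power \<alpha> s T - abel_power T (- s) r - d 0 *\<^sub>R id_blinfun" "d 0 *\<^sub>R id_blinfun"]
      by (simp add: algebra_simps)
  qed
  moreover have "M * C + C * (\<alpha> + 1) \<ge> 0" using M C_nonneg alpha by simp
  ultimately show ?thesis by blast
qed

text \<open>Identities that are Cauchy products for \<open>r < 1\<close> pass to the fractional
  powers through this limit.\<close>

lemma abel_power_tendsto_frac_power: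
  assumes "0 < s" "s < 1"
  shows "(\<lambda>n. abel_power T (- s) (real n / Suc n)) \<longlonglongrightarrow> frac_power \<alpha> s T"
proof -
  obtain K where K: "\<And>r. 0 \<le> r \<Longrightarrow> r < 1 \<Longrightarrow> norm (frac_power \<alpha> s T - abel_power T (- s) r) \<le> K * (1 - r) powr s"
    using frac_power_approx[OF assms] by blast
  have "(\<lambda>n. K * (1 - real n / Suc n) powr s) \<longlonglongrightarrow> 0" using assms by real_asymp
  then have "(\<lambda>n. frac_power \<alpha> s T - abel_power T (- s) (real n / Suc n)) \<longlonglongrightarrow> 0"
    by (rule Lim_null_comparison[rotated]) (intro always_eventually allI K, auto)
  from tendsto_diff[OF tendsto_const[of "frac_power \<alpha> s T"] this] show ?thesis by simp
qed

end

section \<open>Value of the Weyl difference at 0\<close>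

lemma norm_blinfun_compose_le:
  "norm A \<le> a \<Longrightarrow> norm B \<le> b \<Longrightarrow> norm (A o\<^sub>L B) \<le> a * b"
  by (rule order_trans[OF norm_blinfun_compose])
    (meson mult_mono norm_ge_zero order_trans)

lemma blinfun_power_zero_operator: "blinfun_power 0 j = (if j = 0 then id_blinfun else 0)"
  by (cases j) simp_all

lemma Gamma_real_plus1: "x > 0 \<Longrightarrow> Gamma (x + 1) = x * Gamma (x :: real)"
  by (rule Gamma_plus1) (auto elim!: nonpos_Ints_cases)

lemma pochhammer_Gamma_real: "x > 0 \<Longrightarrow> pochhammer (x :: real) n = Gamma (x + n) / Gamma x"
  by (rule pochhammer_Gamma) (auto elim!: nonpos_Ints_cases)

lemma Gamma_reflection_real:
  fixes s :: real
  shows "Gamma s * Gamma (1 - s) = pi / sin (pi * s)"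
proof -
  have "complex_of_real (Gamma s * Gamma (1 - s)) = of_real (pi / sin (pi * s))"
    using Gamma_reflection_complex[of "of_real s"]
    by (simp flip: Gamma_complex_of_real sin_of_real)
  then show ?thesis by (simp only: of_real_eq_iff)
qed

lemma cesaro_sum_zero_operator: "cesaro_sum a 0 n = cesaro_number a n *\<^sub>R id_blinfun"
proof -
  have "cesaro_sum a 0 n = (\<Sum>j\<le>n. if j = 0 then cesaro_number a n *\<^sub>R id_blinfun else 0)"
    unfolding cesaro_sum_def by (intro sum.cong) (auto simp: blinfun_power_zero_operator)
  then show ?thesis by simp
qed

lemma abel_power_zero_operator: "abel_power 0 b r = id_blinfun"
  unfolding abel_power_def
  by (subst suminf_finite[of "{0}"]) (auto simp: blinfun_power_zero_operator)

text \<open>The constant is found by applying the functional calculus to the zero operator on the real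
  line, where \<open>(I - T)\<^sup>s\<close> is the identity.\<close>

lemma weyl_difference_cesaro_number_at_0:
  assumes a: "a \<ge> 0" and s: "0 < s" "s < 1"
  shows "weyl_difference a (cesaro_number (- s)) 0 = Gamma (1 + a + s) / (Gamma (1 + a) * Gamma (1 + s))"
proof (cases "a = 0")
  case True
  have "weyl_difference 0 (cesaro_number (- s)) 0 = 1"
    unfolding weyl_difference_def by (subst suminf_finite[of "{0}"]) auto
  moreover have "Gamma (1 + s) > 0" using s by (intro Gamma_real_pos) auto
  ultimately show ?thesis using True by simp
next
  case False
  then have a0: "a > 0" using a by simp
  interpret cesaro_bounded_operator "0 :: real \<Rightarrow>\<^sub>L real" a 1
  proof
    fix n
    have "cesaro_number a n \<le> cesaro_number (a + 1) n"
      unfolding sum_cesaro_number[symmetric] using a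
      by (intro member_le_sum) (auto simp: cesaro_number_nonneg)
    then show "norm (cesaro_sum a (0 :: real \<Rightarrow>\<^sub>L real) n) \<le> 1 * cesaro_number (a + 1) n"
      using a by (simp add: cesaro_sum_zero_operator cesaro_number_nonneg)
  qed (rule a)
  let ?W = "weyl_difference a (cesaro_number (- s))"
  have "frac_power a s (0 :: real \<Rightarrow>\<^sub>L real) = id_blinfun"
    using abel_power_tendsto_frac_power[OF s] by (simp add: abel_power_zero_operator LIMSEQ_const_iff)
  then have "(\<lambda>j. ?W j *\<^sub>R cesaro_sum a (0 :: real \<Rightarrow>\<^sub>L real) j) sums id_blinfun"
    using frac_power_sums(1)[OF s] by simp
  from bounded_linear.sums[OF blinfun.bounded_linear_left this, of 1]
  \<comment> \<open>For the zero operator only the power \<open>T^0\<close> survives in the Cesaro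
    sums, so the operator series is a scalar one with known sum.\<close>
  have 1: "(\<lambda>j. ?W j * cesaro_number a j) sums 1"
    by (simp add: cesaro_sum_zero_operator blinfun.scaleR_left)
  \<comment> \<open>Writing \<open>k^a(j)\<close> as \<open>a k^(a+1)(j) / (a + j)\<close> brings in
    the closed form, and the series becomes \<open>W 0\<close> times a Beta series.\<close>
  have "?W j * cesaro_number a j = ?W 0 * a * (cesaro_number (- s) j / (a + j))" for j
  proof -
    have "a + j > 0" using a0 by simp
    have "(?W j * cesaro_number a j) * (a + j) = a * (?W j * cesaro_number (a + 1) j)"
      using cesaro_number_plus_one_times[of a j] by (simp add: mult_ac)
    then show ?thesis
      using \<open>a + j > 0\<close> unfolding weyl_difference_cesaro_number[OF a s] by (simp add: field_simps)
  qed
  then have "(\<lambda>j. ?W j * cesaro_number a j) sums (?W 0 * a * Beta a (1 + s))"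
    using Beta_sums[OF a0 s] by (simp only: sums_mult)
  with 1 have W0: "?W 0 * a * Beta a (1 + s) = 1" using sums_unique2 by blast
  have G: "Gamma (1 + a) = a * Gamma a"
    using Gamma_real_plus1[OF a0] by (simp add: add.commute)
  have pos: "Gamma a > 0" "Gamma (1 + s) > 0" "Gamma (1 + a + s) > 0"
    using a0 s by (auto intro!: Gamma_real_pos)
  have B: "Beta a (1 + s) = Gamma a * Gamma (1 + s) / Gamma (1 + a + s)"
    by (simp add: Beta_def add_ac)
  have gen: "w = z / (a * x * y)" if "a * x * y * z \<noteq> 0" "w * a * (x * y / z) = 1" for w x y z :: real
    using that by (simp add: field_simps)
  show ?thesis
    using gen[OF _ W0[unfolded B]] pos a0 unfolding G by simp
qed

section \<open>Commutation rules and the partial sums of the inverse\<close>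

context cesaro_bounded_operator
begin

lemma compose_cesaro_sum_commute:
  assumes "A o\<^sub>L T = T o\<^sub>L A"
  shows "A o\<^sub>L cesaro_sum \<alpha> T n = cesaro_sum \<alpha> T n o\<^sub>L A"
proof -
  have "A o\<^sub>L blinfun_power T j = blinfun_power T j o\<^sub>L A" for j
    by (induction j) (auto simp: blinfun_compose_assoc, metis assms blinfun_compose_assoc)
  then show ?thesis
    by (simp add: cesaro_sum_def blinfun_compose.sum_left blinfun_compose.sum_right
        blinfun_compose.scaleR_left blinfun_compose.scaleR_right)
qed

text \<open>An arbitrary commuting \<open>A\<close> is allowed because three are needed:
  \<open>T\<close> itself, its Cesaro sums, and multiplication by a complex scalar.\<close>

lemma compose_frac_power_commute:
  assumes "A o\<^sub>L T = T o\<^sub>L A" "0 < s" "s < 1"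
  shows "A o\<^sub>L frac_power \<alpha> s T = frac_power \<alpha> s T o\<^sub>L A"
proof -
  let ?W = "weyl_difference \<alpha> (cesaro_number (- s))"
  have "(\<lambda>j. A o\<^sub>L ?W j *\<^sub>R cesaro_sum \<alpha> T j) sums (A o\<^sub>L frac_power \<alpha> s T)"
    by (rule blinfun_compose.bounded_linear_right[THEN bounded_linear.sums, OF frac_power_sums(1)[OF assms(2,3)]])
  moreover have "(\<lambda>j. ?W j *\<^sub>R cesaro_sum \<alpha> T j o\<^sub>L A) sums (frac_power \<alpha> s T o\<^sub>L A)"
    by (rule blinfun_compose.bounded_linear_left[THEN bounded_linear.sums, OF frac_power_sums(1)[OF assms(2,3)]])
  ultimately show ?thesis
    by (simp add: blinfun_compose.scaleR_left blinfun_compose.scaleR_right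
        compose_cesaro_sum_commute[OF assms(1)] sums_iff)
qed

text \<open>The limit of \<open>(I - rT)^(1-s) (I - rT)^s = I - rT\<close> along
  \<open>r = n / (n + 1)\<close>.\<close>

lemma frac_power_compose_complement:
  assumes "0 < s" "s < 1"
  shows "frac_power \<alpha> (1 - s) T o\<^sub>L frac_power \<alpha> s T = id_blinfun - T"
proof -
  let ?r = "\<lambda>n. real n / Suc n"
  have "(\<lambda>n. abel_power T (- (1 - s)) (?r n) o\<^sub>L abel_power T (- s) (?r n)) \<longlonglongrightarrow>
      (frac_power \<alpha> (1 - s) T o\<^sub>L frac_power \<alpha> s T)"
    using assms by (intro blinfun_compose.tendsto abel_power_tendsto_frac_power) auto
  moreover have "abel_power T (- (1 - s)) (?r n) o\<^sub>L abel_power T (- s) (?r n) = id_blinfun - ?r n *\<^sub>R T" for n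
    using assms by (subst abel_power_compose) (auto simp: abel_power_minus_one)
  moreover have "(\<lambda>n. id_blinfun - ?r n *\<^sub>R T) \<longlonglongrightarrow> id_blinfun - 1 *\<^sub>R T"
    by (intro tendsto_intros LIMSEQ_n_over_Suc_n)
  ultimately show ?thesis using LIMSEQ_unique by auto
qed

text \<open>Formally the Weyl differences of \<open>k^s\<close>. The constant makes the increments
  equal to the Weyl coefficients of \<open>(I - T)^(1-s)\<close>: both are multiples of
  \<open>k^s(j) / ((j + 1) k^(\<alpha>+1)(j + 1))\<close>, and comparing the factors gives
  \<open>(1 - s) / (\<alpha> + 1 - s)\<close>.\<close>

definition inverse_coeff :: "real \<Rightarrow> nat \<Rightarrow> real" where
  "inverse_coeff s j = weyl_difference \<alpha> (cesaro_number (- (1 - s))) 0 * (1 - s) / (\<alpha> + 1 - s)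
     * cesaro_number s j / cesaro_number (\<alpha> + 1) j"

definition partial_inverse :: "real \<Rightarrow> nat \<Rightarrow> 'a \<Rightarrow>\<^sub>L 'a" where
  "partial_inverse s N = (\<Sum>j\<le>N. inverse_coeff s j *\<^sub>R cesaro_sum \<alpha> T j)"

text \<open>The Weyl difference at exponent \<open>1 - s\<close> contributes
  \<open>1 / Gamma (1 - s)\<close> and \<open>k^s\<close> contributes \<open>1 / Gamma s\<close>;
  the reflection formula turns the product into \<open>sin (pi * s) / pi\<close>.\<close>

lemma inverse_coeff_eq_Gamma:
  assumes s: "0 < s" "s < 1"
  shows "inverse_coeff s n = sin (pi * s) * Gamma (1 - s + \<alpha>) / pi * (Gamma (s + real n) / Gamma (real n + \<alpha> + 1))"
proof -
  have pos: "Gamma s > 0" "Gamma (1 - s) > 0" "Gamma (1 - s + \<alpha>) > 0" "Gamma (1 + \<alpha>) > 0"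
      "Gamma (s + real n) > 0" "Gamma (real n + \<alpha> + 1) > 0"
    using s alpha by (auto intro!: Gamma_real_pos)
  have eq: "1 + \<alpha> + (1 - s) = (1 - s + \<alpha>) + 1" "1 + (1 - s) = (1 - s) + 1" by simp_all
  have G1: "Gamma (1 + \<alpha> + (1 - s)) = (1 - s + \<alpha>) * Gamma (1 - s + \<alpha>)"
    unfolding eq using s alpha by (intro Gamma_real_plus1) auto
  have G2: "Gamma (1 + (1 - s)) = (1 - s) * Gamma (1 - s)"
    unfolding eq using s by (intro Gamma_real_plus1) auto
  have k1: "cesaro_number s n = Gamma (s + n) / Gamma s / fact n"
    using s by (subst cesaro_number_def, subst pochhammer_Gamma_real) auto
  have k2: "cesaro_number (\<alpha> + 1) n = Gamma (real n + \<alpha> + 1) / Gamma (1 + \<alpha>) / fact n"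
    using alpha by (subst cesaro_number_def, subst pochhammer_Gamma_real) (auto simp: add_ac)
  have refl: "sin (pi * s) = pi / (Gamma s * Gamma (1 - s))"
    unfolding Gamma_reflection_real by simp
  have W: "weyl_difference \<alpha> (cesaro_number (- (1 - s))) 0 =
      (1 - s + \<alpha>) * Gamma (1 - s + \<alpha>) / (Gamma (1 + \<alpha>) * ((1 - s) * Gamma (1 - s)))"
    using weyl_difference_cesaro_number_at_0[OF alpha, of "1 - s"] s unfolding G1 G2 by simp
  have ne: "1 - s + \<alpha> \<noteq> 0" "1 - s \<noteq> 0" using s alpha by auto
  have e: "\<alpha> + 1 - s = 1 - s + \<alpha>" by simp
  have gen: "(q * g1) / (ga * (p * g2)) * p / q * (gn / gs / F) / (gm / ga / F) =
      pi / (gs * g2) * g1 / pi * (gn / gm)"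
    if "q \<noteq> 0" "p \<noteq> 0" "ga \<noteq> 0" "g2 \<noteq> 0" "gs \<noteq> 0" "gm \<noteq> 0" "F \<noteq> 0" for q p g1 ga g2 gn gs gm F :: real
    using that by (simp add: field_simps)
  show ?thesis
    unfolding inverse_coeff_def W k1 k2 refl e using pos ne by (intro gen) auto
qed

text \<open>This lets the summation by parts in \<open>partial_inverse_compose\<close> reproduce the
  series for \<open>(I - T)^(1-s)\<close>.\<close>

lemma inverse_coeff_diff:
  assumes s: "0 < s" "s < 1"
  shows "inverse_coeff s (Suc j) - inverse_coeff s j = weyl_difference \<alpha> (cesaro_number (- (1 - s))) (Suc j)"
proof -
  let ?W = "weyl_difference \<alpha> (cesaro_number (- (1 - s)))"
  have k: "cesaro_number (\<alpha> + 1) n > 0" for n using alpha by (simp add: cesaro_number_pos)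
  define \<beta> where "\<beta> = ?W 0 * (1 - s) / (\<alpha> + 1 - s)"
  have b: "inverse_coeff s n = \<beta> * cesaro_number s n / cesaro_number (\<alpha> + 1) n" for n
    by (simp add: inverse_coeff_def \<beta>_def)
  have kS: "cesaro_number (\<alpha> + 1) (Suc j) = cesaro_number (\<alpha> + 1) j * (\<alpha> + 1 + j) / Suc j"
    by (rule cesaro_number_Suc)
  have "inverse_coeff s j * cesaro_number (\<alpha> + 1) (Suc j) = \<beta> * cesaro_number s j * (\<alpha> + 1 + j) / Suc j"
    using k[of j] unfolding b kS by simp
  moreover have "inverse_coeff s (Suc j) * cesaro_number (\<alpha> + 1) (Suc j) = \<beta> * cesaro_number s j * (s + j) / Suc j"
    using k[of "Suc j"] unfolding b by (simp add: cesaro_number_Suc[of s])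
  ultimately have "(inverse_coeff s (Suc j) - inverse_coeff s j) * cesaro_number (\<alpha> + 1) (Suc j) =
      - (\<beta> * (\<alpha> + 1 - s)) * cesaro_number s j / Suc j"
    by (simp add: left_diff_distrib field_simps)
  also have "\<beta> * (\<alpha> + 1 - s) = ?W 0 * (1 - s)"
    using s alpha by (simp add: \<beta>_def)
  also have "- (?W 0 * (1 - s)) * cesaro_number s j / Suc j = ?W 0 * cesaro_number (- (1 - s)) (Suc j)"
    using cesaro_number_minus_Suc[of "1 - s" j] by (simp add: left_diff_distrib right_diff_distrib minus_divide_left)
  also have "\<dots> = ?W (Suc j) * cesaro_number (\<alpha> + 1) (Suc j)"
    using weyl_difference_cesaro_number[OF alpha, of "1 - s" "Suc j"] s by simp
  finally show ?thesis using k[of "Suc j"] by simp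
qed

text \<open>Summation by parts with
  \<open>S_j (I - T) = k^\<alpha>(j + 1) I - S_(j+1) + S_j\<close>. Besides the partial sum of the
  series for \<open>(I - T)^(1-s)\<close>, only boundary terms at \<open>N\<close> remain, all of
  size \<open>O(k^s(N))\<close>.\<close>

lemma partial_inverse_compose:
  assumes s: "0 < s" "s < 1"
  defines "W \<equiv> weyl_difference \<alpha> (cesaro_number (- (1 - s)))"
  shows "partial_inverse s N o\<^sub>L (id_blinfun - T) =
    (inverse_coeff s N * cesaro_number (\<alpha> + 1) (Suc N) - W 0 * cesaro_number s N) *\<^sub>R id_blinfun
    + (\<Sum>j\<le>N. W j *\<^sub>R cesaro_sum \<alpha> T j) - inverse_coeff s N *\<^sub>R cesaro_sum \<alpha> T (Suc N)"
proof (induction N)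
  case 0
  show ?case
    by (simp add: partial_inverse_def blinfun_compose.scaleR_left cesaro_number_Suc
        cesaro_sum_def[of \<alpha> T "Suc 0"] algebra_simps)
next
  case (Suc N)
  let ?b = "inverse_coeff s" and ?k = "cesaro_number (\<alpha> + 1)" and ?S = "cesaro_sum \<alpha> T"
  have W: "W (Suc N) = ?b (Suc N) - ?b N" unfolding W_def by (rule inverse_coeff_diff[OF s, symmetric])
  have "W 0 * cesaro_number s (Suc N) - W 0 * cesaro_number s N = W 0 * cesaro_number (- (1 - s)) (Suc N)"
    using cesaro_number_diff[of s N] by (simp flip: right_diff_distrib)
  also have "\<dots> = W (Suc N) * ?k (Suc N)"
    unfolding W_def using weyl_difference_cesaro_number[OF alpha, of "1 - s" "Suc N"] s by simp
  finally have k: "W 0 * cesaro_number s (Suc N) = W 0 * cesaro_number s N + (?b (Suc N) - ?b N) * ?k (Suc N)"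
    by (simp add: W)
  have ka: "cesaro_number \<alpha> (Suc (Suc N)) = ?k (Suc (Suc N)) - ?k (Suc N)"
    using cesaro_number_diff[of "\<alpha> + 1" "Suc N"] by simp
  have "partial_inverse s (Suc N) o\<^sub>L (id_blinfun - T) =
      (partial_inverse s N o\<^sub>L (id_blinfun - T)) + ?b (Suc N) *\<^sub>R (?S (Suc N) o\<^sub>L (id_blinfun - T))"
    by (simp add: partial_inverse_def blinfun_compose.add_left blinfun_compose.scaleR_left)
  also have "\<dots> = (?b (Suc N) * ?k (Suc (Suc N)) - W 0 * cesaro_number s (Suc N)) *\<^sub>R id_blinfun
    + (\<Sum>j\<le>Suc N. W j *\<^sub>R ?S j) - ?b (Suc N) *\<^sub>R ?S (Suc (Suc N))"
    unfolding Suc.IH cesaro_sum_diff_compose ka k by (simp add: W algebra_simps)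
  finally show ?case .
qed

text \<open>The rate matters and not only the convergence: in
  \<open>partial_inverse_frac_power_bounded\<close> it compensates a factor of norm
  \<open>O(N^(1-s))\<close>.\<close>

lemma partial_inverse_approx:
  assumes s: "0 < s" "s < 1"
  shows "\<exists>K\<ge>0. \<forall>N. norm ((partial_inverse s N o\<^sub>L (id_blinfun - T)) - frac_power \<alpha> (1 - s) T)
    \<le> K * real (Suc N) powr (s - 1)"
proof -
  let ?W = "weyl_difference \<alpha> (cesaro_number (- (1 - s)))"
  let ?S = "cesaro_sum \<alpha> T" and ?b = "inverse_coeff s"
  define \<beta> where "\<beta> = ?W 0 * (1 - s) / (\<alpha> + 1 - s)"
  obtain K where K: "K > 0" "\<And>n. cesaro_number s n \<le> K * real (Suc n) powr (s - 1)"
    using cesaro_number_bigo[of s] s by auto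
  have s': "0 < 1 - s" "1 - s < 1" using s by auto
  have bk: "\<bar>?b N\<bar> * cesaro_number (\<alpha> + 1) (Suc N) \<le> \<bar>\<beta>\<bar> * (\<alpha> + 1) * cesaro_number s N" for N
  proof -
    have "\<bar>?b N\<bar> * cesaro_number (\<alpha> + 1) (Suc N) \<le> \<bar>?b N\<bar> * ((\<alpha> + 1) * cesaro_number (\<alpha> + 1) N)"
      by (intro mult_left_mono cesaro_number_Suc_le alpha) auto
    also have "\<dots> = \<bar>\<beta>\<bar> * (\<alpha> + 1) * cesaro_number s N"
      using cesaro_number_pos[of "\<alpha> + 1" N] cesaro_number_pos[of s N] alpha s
      by (simp add: inverse_coeff_def \<beta>_def abs_mult)
    finally show ?thesis .
  qed
  define K' where "K' = \<bar>\<beta>\<bar> * (\<alpha> + 1) + \<bar>?W 0\<bar> + C * \<bar>\<beta>\<bar> * (\<alpha> + 1) + C * \<bar>?W 0\<bar>"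
  have K'0: "K' \<ge> 0" using alpha C_nonneg by (simp add: K'_def)
  have "norm ((partial_inverse s N o\<^sub>L (id_blinfun - T)) - frac_power \<alpha> (1 - s) T) \<le> K' * cesaro_number s N" for N
  proof -
    let ?c = "?b N * cesaro_number (\<alpha> + 1) (Suc N) - ?W 0 * cesaro_number s N"
    have tail: "(\<lambda>j. ?W (j + Suc N) *\<^sub>R ?S (j + Suc N)) sums
        (frac_power \<alpha> (1 - s) T - (\<Sum>j\<le>N. ?W j *\<^sub>R ?S j))"
      using sums_split_initial_segment[OF frac_power_sums(1)[OF s'], of "Suc N"]
      by (simp only: lessThan_Suc_atMost)
    \<comment> \<open>The signed sum is 0 and the term at 0 is 1, so the absolute sum is 2, and the
      tail beyond \<open>N\<close> is exactly \<open>k^s(N)\<close>.\<close>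
    have "(\<lambda>j. \<bar>cesaro_number (- (1 - s)) j\<bar>) sums 2"
    proof -
      have "(\<lambda>N. 2 - cesaro_number (1 - (1 - s)) N) \<longlonglongrightarrow> 2 - 0"
        using cesaro_number_minus_sums[OF s'] by (intro tendsto_intros) (simp add: sums_def_le sum_cesaro_number)
      then show ?thesis
        unfolding sums_def_le using s' by (subst sum_cesaro_number_minus) auto
    qed
    from sums_split_initial_segment[OF this, of "Suc N"]
    have "(\<lambda>j. \<bar>cesaro_number (- (1 - s)) (j + Suc N)\<bar>) sums cesaro_number s N"
      using sum_cesaro_number_minus[of "1 - s" N] s' unfolding lessThan_Suc_atMost by simp
    from sums_mult[OF this, of "C * \<bar>?W 0\<bar>"]
    have tk: "(\<lambda>j. C * \<bar>?W 0\<bar> * \<bar>cesaro_number (- (1 - s)) (j + Suc N)\<bar>) sums (C * \<bar>?W 0\<bar> * cesaro_number s N)" .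
    have 1: "norm (frac_power \<alpha> (1 - s) T - (\<Sum>j\<le>N. ?W j *\<^sub>R ?S j)) \<le> C * \<bar>?W 0\<bar> * cesaro_number s N"
      unfolding sums_unique[OF tail] sums_unique[OF tk]
      by (rule norm_suminf_le[OF frac_power_sums(2)[OF s'] sums_summable[OF tk]])
    have 2: "norm (?b N *\<^sub>R ?S (Suc N)) \<le> C * \<bar>\<beta>\<bar> * (\<alpha> + 1) * cesaro_number s N"
    proof -
      have "norm (?b N *\<^sub>R ?S (Suc N)) \<le> \<bar>?b N\<bar> * (C * cesaro_number (\<alpha> + 1) (Suc N))"
        unfolding norm_scaleR by (intro mult_left_mono norm_cesaro_sum) auto
      also have "\<dots> = C * (\<bar>?b N\<bar> * cesaro_number (\<alpha> + 1) (Suc N))" by simp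
      also have "\<dots> \<le> C * (\<bar>\<beta>\<bar> * (\<alpha> + 1) * cesaro_number s N)"
        by (intro mult_left_mono bk C_nonneg)
      finally show ?thesis by (simp add: mult_ac)
    qed
    have ks: "cesaro_number s N \<ge> 0" using s by (simp add: cesaro_number_nonneg)
    have "\<bar>?c\<bar> \<le> \<bar>?b N\<bar> * cesaro_number (\<alpha> + 1) (Suc N) + \<bar>?W 0\<bar> * cesaro_number s N"
      using abs_triangle_ineq4[of "?b N * cesaro_number (\<alpha> + 1) (Suc N)" "?W 0 * cesaro_number s N"]
        cesaro_number_nonneg[of "\<alpha> + 1" "Suc N"] ks alpha by (simp add: abs_mult)
    also have "\<dots> \<le> (\<bar>\<beta>\<bar> * (\<alpha> + 1) + \<bar>?W 0\<bar>) * cesaro_number s N"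
      using bk[of N] by (simp add: algebra_simps)
    finally have "\<bar>?c\<bar> * norm (id_blinfun :: 'a \<Rightarrow>\<^sub>L 'a) \<le> (\<bar>\<beta>\<bar> * (\<alpha> + 1) + \<bar>?W 0\<bar>) * cesaro_number s N * 1"
      by (rule mult_mono[OF _ norm_blinfun_id_le]) (use ks alpha in auto)
    then have 3: "norm (?c *\<^sub>R (id_blinfun :: 'a \<Rightarrow>\<^sub>L 'a)) \<le> (\<bar>\<beta>\<bar> * (\<alpha> + 1) + \<bar>?W 0\<bar>) * cesaro_number s N"
      by simp
    have "(partial_inverse s N o\<^sub>L (id_blinfun - T)) - frac_power \<alpha> (1 - s) T =
        ?c *\<^sub>R id_blinfun - ?b N *\<^sub>R ?S (Suc N) - (frac_power \<alpha> (1 - s) T - (\<Sum>j\<le>N. ?W j *\<^sub>R ?S j))"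
      unfolding partial_inverse_compose[OF s] by simp
    also have "norm \<dots> \<le> (\<bar>\<beta>\<bar> * (\<alpha> + 1) + \<bar>?W 0\<bar>) * cesaro_number s N + C * \<bar>\<beta>\<bar> * (\<alpha> + 1) * cesaro_number s N
        + C * \<bar>?W 0\<bar> * cesaro_number s N"
      by (rule order_trans[OF norm_triangle_ineq4 add_mono[OF order_trans[OF norm_triangle_ineq4 add_mono[OF 3 2]] 1]])
    also have "\<dots> = K' * cesaro_number s N" by (simp add: K'_def algebra_simps)
    finally show ?thesis .
  qed
  then have "norm ((partial_inverse s N o\<^sub>L (id_blinfun - T)) - frac_power \<alpha> (1 - s) T) \<le> K' * K * real (Suc N) powr (s - 1)" for N
    using mult_left_mono[OF K(2)[of N] K'0] order_trans unfolding mult.assoc by blast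
  moreover have "K' * K \<ge> 0" using K'0 K(1) by simp
  ultimately show ?thesis by blast
qed

text \<open>In each term the growth of the Cesaro sum cancels and a multiple of
  \<open>k^s(j)\<close> remains; these add up to \<open>k^(s+1)(N)\<close>.\<close>

lemma norm_partial_inverse_le:
  assumes s: "0 < s" "s < 1"
  shows "\<exists>K\<ge>0. \<forall>N. norm (partial_inverse s N) \<le> K * real (Suc N) powr s"
proof -
  define \<beta> where "\<beta> = weyl_difference \<alpha> (cesaro_number (- (1 - s))) 0 * (1 - s) / (\<alpha> + 1 - s)"
  obtain K where K: "K > 0" "\<And>n. cesaro_number (s + 1) n \<le> K * real (Suc n) powr (s + 1 - 1)"
    using cesaro_number_bigo[of "s + 1"] s by auto
  have "norm (partial_inverse s N) \<le> C * \<bar>\<beta>\<bar> * K * real (Suc N) powr s" for N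
  proof -
    have "norm (partial_inverse s N) \<le> (\<Sum>j\<le>N. C * \<bar>\<beta>\<bar> * cesaro_number s j)"
      unfolding partial_inverse_def
    proof (rule order_trans[OF norm_sum sum_mono])
      fix j
      have "norm (inverse_coeff s j *\<^sub>R cesaro_sum \<alpha> T j) \<le> \<bar>inverse_coeff s j\<bar> * (C * cesaro_number (\<alpha> + 1) j)"
        unfolding norm_scaleR by (intro mult_left_mono norm_cesaro_sum) auto
      also have "\<dots> = C * \<bar>\<beta>\<bar> * cesaro_number s j"
        using cesaro_number_pos[of "\<alpha> + 1" j] cesaro_number_pos[of s j] alpha s
        by (simp add: inverse_coeff_def \<beta>_def abs_mult)
      finally show "norm (inverse_coeff s j *\<^sub>R cesaro_sum \<alpha> T j) \<le> C * \<bar>\<beta>\<bar> * cesaro_number s j" .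
    qed
    also have "\<dots> = C * \<bar>\<beta>\<bar> * cesaro_number (s + 1) N"
      by (simp add: sum_cesaro_number flip: sum_distrib_left)
    also have "\<dots> \<le> C * \<bar>\<beta>\<bar> * (K * real (Suc N) powr s)"
      using K(2)[of N] C_nonneg by (intro mult_left_mono) auto
    finally show ?thesis by (simp add: mult_ac)
  qed
  moreover have "C * \<bar>\<beta>\<bar> * K \<ge> 0" using C_nonneg K by simp
  ultimately show ?thesis by blast
qed

text \<open>With \<open>1 - r = 1/(N + 1)\<close>, the partial sum is compared with \<open>(I - rT)\<^sup>-\<^sup>s\<close>: the difference has
  norm \<open>O(N\<^sup>s)\<close> and, multiplied by \<open>I - T\<close>, norm \<open>O(N\<^sup>s\<^sup>-\<^sup>1)\<close>, while \<open>(I - T)\<^sup>s\<close> is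
  \<open>(I - T)(I - rT)\<^sup>s\<^sup>-\<^sup>1\<close>, a product with a factor of norm \<open>O(N\<^sup>1\<^sup>-\<^sup>s)\<close>, up to an error \<open>O(N\<^sup>-\<^sup>s)\<close>.\<close>

lemma partial_inverse_frac_power_bounded:
  assumes s: "0 < s" "s < 1"
  shows "\<exists>K. \<forall>N. norm (partial_inverse s N o\<^sub>L frac_power \<alpha> s T) \<le> K"
proof -
  let ?F = "frac_power \<alpha> s T" and ?G = "frac_power \<alpha> (1 - s) T" and ?I = "id_blinfun :: 'a \<Rightarrow>\<^sub>L 'a"
  have s': "0 < 1 - s" "1 - s < 1" using s by auto
  obtain K1 where K1: "K1 \<ge> 0" "\<And>r. 0 \<le> r \<Longrightarrow> r < 1 \<Longrightarrow> norm (?F - abel_power T (- s) r) \<le> K1 * (1 - r) powr s"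
    using frac_power_approx[OF s] by blast
  obtain K2 where K2: "K2 \<ge> 0" "\<And>r. 0 \<le> r \<Longrightarrow> r < 1 \<Longrightarrow> norm (?G - abel_power T (- (1 - s)) r) \<le> K2 * (1 - r) powr (1 - s)"
    using frac_power_approx[OF s'] by blast
  obtain K3 where K3: "K3 \<ge> 0" "\<And>N. norm (partial_inverse s N) \<le> K3 * real (Suc N) powr s"
    using norm_partial_inverse_le[OF s] by blast
  obtain K4 where K4: "K4 \<ge> 0" "\<And>N. norm ((partial_inverse s N o\<^sub>L (?I - T)) - ?G) \<le> K4 * real (Suc N) powr (s - 1)"
    using partial_inverse_approx[OF s] by blast
  define t where "t = norm T"
  have "norm (partial_inverse s N o\<^sub>L ?F) \<le>
      C * K1 + 1 + (K3 + C) * K1 + (K4 + K2 + C * t) * C + (K3 + C) * t * C" for N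
  proof -
    define r where "r = real N / real (Suc N)"
    \<comment> \<open>Since \<open>(1 - r) u v = 1\<close>, all the errors below are of order
      \<open>u\<close>, \<open>1 / u\<close>, \<open>v\<close> or \<open>1 / v\<close>, and they
      meet in products that cancel.\<close>
    define u where "u = real (Suc N) powr s"
    define v where "v = real (Suc N) powr (1 - s)"
    have r: "0 \<le> r" "r < 1" by (auto simp: r_def)
    have uv: "u > 0" "v > 0" by (auto simp: u_def v_def)
    have r1: "1 - r = 1 / real (Suc N)" by (simp add: r_def field_simps)
    have r1uv: "1 - r = 1 / (u * v)"
      unfolding r1 u_def v_def by (simp add: powr_add[symmetric])
    have rs: "(1 - r) powr s = 1 / u" "(1 - r) powr (1 - s) = 1 / v"
        "(1 - r) powr (- s) = u" "(1 - r) powr (- (1 - s)) = v" "real (Suc N) powr (s - 1) = 1 / v"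
      unfolding r1 u_def v_def by (auto simp: powr_divide powr_minus_divide powr_diff field_simps)
    define R where "R = partial_inverse s N"
    define B where "B = abel_power T s r"
    define P where "P = abel_power T (- s) r"
    define H where "H = abel_power T (1 - s) r"
    define Q where "Q = abel_power T (- (1 - s)) r"
    have nB: "norm B \<le> C * u"
      using norm_abel_power_le[OF r, of s] s unfolding B_def rs by simp
    have nH: "norm H \<le> C * v"
      using norm_abel_power_le[OF r, of "1 - s"] s unfolding H_def rs by simp
    have nFP: "norm (?F - P) \<le> K1 * (1 / u)"
      using K1(2)[OF r] unfolding P_def rs .
    have nGQ: "norm (?G - Q) \<le> K2 * (1 / v)"
      using K2(2)[OF r] unfolding Q_def rs .
    have nR: "norm R \<le> K3 * u" using K3(2)[of N] unfolding R_def u_def .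
    have nRG: "norm ((R o\<^sub>L (?I - T)) - ?G) \<le> K4 * (1 / v)" using K4(2)[of N] unfolding R_def rs .
    have nRB: "norm (R - B) \<le> (K3 + C) * u"
      using norm_triangle_ineq4[of R B] nR nB by (simp add: algebra_simps)
    have BP: "B o\<^sub>L P = ?I"
      unfolding B_def P_def using s by (subst abel_power_compose[OF r]) (auto simp: abel_power_0)
    \<comment> \<open>Here \<open>P = (I - rT) H\<close> and
      \<open>I - rT = (I - T) + (1 - r) T\<close>. The same splitting is used for
      \<open>Q = B (I - rT)\<close> below.\<close>
    have P: "P = ((?I - T) o\<^sub>L H) + (1 - r) *\<^sub>R (T o\<^sub>L H)"
    proof -
      have "P = abel_power T (- 1) r o\<^sub>L H"
        unfolding P_def H_def using s by (subst abel_power_compose[OF r]) auto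
      then show ?thesis
        by (simp add: abel_power_minus_one blinfun_compose.diff_left blinfun_compose.scaleR_left scaleR_left_diff_distrib)
    qed
    have BI: "B o\<^sub>L (?I - T) = Q - (1 - r) *\<^sub>R (B o\<^sub>L T)"
    proof -
      have "Q = B o\<^sub>L abel_power T (- 1) r"
        unfolding Q_def B_def using s by (subst abel_power_compose[OF r]) auto
      then show ?thesis
        by (simp add: abel_power_minus_one blinfun_compose.diff_right blinfun_compose.scaleR_right scaleR_left_diff_distrib)
    qed
    have nBT: "norm ((1 - r) *\<^sub>R (B o\<^sub>L T)) \<le> (1 / (u * v)) * (C * u * t)"
      unfolding r1uv norm_scaleR using uv nB
      by (intro mult_mono norm_blinfun_compose_le) (auto simp: t_def)
    have nRBI: "norm ((R - B) o\<^sub>L (?I - T)) \<le> (K4 + K2 + C * t) * (1 / v)"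
    proof -
      have "(R - B) o\<^sub>L (?I - T) = ((R o\<^sub>L (?I - T)) - ?G) + (?G - Q) + (1 - r) *\<^sub>R (B o\<^sub>L T)"
        by (simp add: blinfun_compose.diff_left BI)
      also have "norm \<dots> \<le> K4 * (1 / v) + K2 * (1 / v) + (1 / (u * v)) * (C * u * t)"
        by (rule order_trans[OF norm_triangle_ineq add_mono[OF order_trans[OF norm_triangle_ineq add_mono[OF nRG nGQ]] nBT]])
      also have "\<dots> = (K4 + K2 + C * t) * (1 / v)" using uv by (simp add: field_simps)
      finally show ?thesis .
    qed
    have 1: "norm (B o\<^sub>L (?F - P)) \<le> C * K1"
      using norm_blinfun_compose_le[OF nB nFP] uv by simp
    have 2: "norm ((R - B) o\<^sub>L (?F - P)) \<le> (K3 + C) * K1"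
      using norm_blinfun_compose_le[OF nRB nFP] uv by simp
    have 3: "norm (((R - B) o\<^sub>L (?I - T)) o\<^sub>L H) \<le> (K4 + K2 + C * t) * C"
      using norm_blinfun_compose_le[OF nRBI nH] uv by (simp add: mult.commute[of C v])
    have 4: "norm ((1 - r) *\<^sub>R ((R - B) o\<^sub>L (T o\<^sub>L H))) \<le> (K3 + C) * t * C"
    proof -
      have "norm ((1 - r) *\<^sub>R ((R - B) o\<^sub>L (T o\<^sub>L H))) \<le> (1 / (u * v)) * ((K3 + C) * u * (t * (C * v)))"
        unfolding r1uv norm_scaleR using uv nRB nH K3(1) C_nonneg
        by (intro mult_mono norm_blinfun_compose_le) (auto simp: t_def)
      also have "\<dots> = (K3 + C) * t * C" using uv by (simp add: field_simps)
      finally show ?thesis .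
    qed
    \<comment> \<open>With \<open>F\<close> the fractional power,
      \<open>R F = B (F - P) + B P + (R - B) (F - P) + (R - B) P\<close>. Here
      \<open>B P = I\<close>, and the last product is split by the formula for
      \<open>P\<close>.\<close>
    have "R o\<^sub>L ?F = (B o\<^sub>L (?F - P)) + ?I + ((R - B) o\<^sub>L (?F - P)) + (((R - B) o\<^sub>L (?I - T)) o\<^sub>L H)
        + (1 - r) *\<^sub>R ((R - B) o\<^sub>L (T o\<^sub>L H))"
    proof -
      have "(R - B) o\<^sub>L P = (((R - B) o\<^sub>L (?I - T)) o\<^sub>L H) + (1 - r) *\<^sub>R ((R - B) o\<^sub>L (T o\<^sub>L H))"
        unfolding P blinfun_compose.add_right blinfun_compose.scaleR_right blinfun_compose_assoc ..
      then have "(B o\<^sub>L (?F - P)) + ?I + ((R - B) o\<^sub>L (?F - P)) + (((R - B) o\<^sub>L (?I - T)) o\<^sub>L H)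
        + (1 - r) *\<^sub>R ((R - B) o\<^sub>L (T o\<^sub>L H)) = (B o\<^sub>L (?F - P)) + (B o\<^sub>L P) + ((R - B) o\<^sub>L (?F - P)) + ((R - B) o\<^sub>L P)"
        by (simp add: BP)
      also have "\<dots> = R o\<^sub>L ?F"
        by (simp add: blinfun_compose.diff_left blinfun_compose.diff_right)
      finally show ?thesis ..
    qed
    also have "norm \<dots> \<le> C * K1 + 1 + (K3 + C) * K1 + (K4 + K2 + C * t) * C + (K3 + C) * t * C"
      by (intro order_trans[OF norm_triangle_ineq] add_mono 1 2 3 4 norm_blinfun_id_le)
    finally show ?thesis unfolding R_def .
  qed
  then show ?thesis by blast
qed

end

section \<open>Strong convergence of the partial sums\<close>

lemma blinfun_tendsto_id_dense:
  fixes A :: "nat \<Rightarrow> 'a::real_normed_vector \<Rightarrow>\<^sub>L 'a"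
  assumes bound: "\<And>n. norm (A n) \<le> K" and dense: "closure D = UNIV"
    and lim: "\<And>d. d \<in> D \<Longrightarrow> (\<lambda>n. A n d) \<longlonglongrightarrow> d"
  shows "(\<lambda>n. A n x) \<longlonglongrightarrow> x"
proof (rule LIMSEQ_I)
  fix e :: real assume e: "e > 0"
  have K: "K \<ge> 0" using order_trans[OF norm_ge_zero bound] .
  define \<delta> where "\<delta> = e / 2 / (K + 1)"
  have \<delta>: "\<delta> > 0" using e K by (simp add: \<delta>_def)
  have "x \<in> closure D" using dense by simp
  then obtain d where d: "d \<in> D" "dist d x < \<delta>"
    using \<delta> unfolding closure_approachable by blast
  obtain N where N: "\<And>n. n \<ge> N \<Longrightarrow> norm (A n d - d) < e / 2"
    using LIMSEQ_D[OF lim[OF d(1)], of "e / 2"] e by auto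
  have "norm (A n x - x) < e" if "n \<ge> N" for n
  proof -
    have dx: "norm (x - d) \<le> \<delta>" "norm (d - x) \<le> \<delta>" using d(2) by (auto simp: dist_norm norm_minus_commute)
    have "norm (A n (x - d)) \<le> K * \<delta>"
      using order_trans[OF norm_blinfun mult_mono[OF bound dx(1) K norm_ge_zero]] .
    moreover have eq: "A n x - x = A n (x - d) + (A n d - d) + (d - x)"
      by (simp add: blinfun.diff_right)
    ultimately have "norm (A n x - x) < K * \<delta> + e / 2 + \<delta>"
      unfolding eq using N[OF that] dx(2) norm_triangle_ineq[of "A n (x - d) + (A n d - d)" "d - x"]
        norm_triangle_ineq[of "A n (x - d)" "A n d - d"] by linarith
    also have "\<dots> = (K + 1) * \<delta> + e / 2" by (simp add: algebra_simps)
    also have "(K + 1) * \<delta> = e / 2"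
    proof -
      have "x * (y / x) = y" if "x \<noteq> 0" for x y :: real using that by simp
      then show ?thesis unfolding \<delta>_def using K by (metis add_nonneg_eq_0_iff zero_le_one zero_neq_one)
    qed
    finally show ?thesis by simp
  qed
  then show "\<exists>N. \<forall>n\<ge>N. norm (A n x - x) < e" by blast
qed

context cesaro_bounded_operator
begin

lemma partial_inverse_commute:
  assumes "0 < s" "s < 1"
  shows "partial_inverse s N o\<^sub>L frac_power \<alpha> s T = frac_power \<alpha> s T o\<^sub>L partial_inverse s N"
proof -
  have "cesaro_sum \<alpha> T j o\<^sub>L frac_power \<alpha> s T = frac_power \<alpha> s T o\<^sub>L cesaro_sum \<alpha> T j" for j
    by (rule compose_frac_power_commute[OF compose_cesaro_sum_commute[OF refl, symmetric] assms])
  then show ?thesis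
    by (simp add: partial_inverse_def blinfun_compose.sum_left blinfun_compose.sum_right
        blinfun_compose.scaleR_left blinfun_compose.scaleR_right)
qed

lemma partial_inverse_tendsto:
  assumes dense: "closure (range (\<lambda>y. y - T y)) = UNIV" and s: "0 < s" "s < 1"
  shows "(\<lambda>N. partial_inverse s N (frac_power \<alpha> s T y)) \<longlonglongrightarrow> y"
proof -
  let ?F = "frac_power \<alpha> s T" and ?G = "frac_power \<alpha> (1 - s) T" and ?I = "id_blinfun :: 'a \<Rightarrow>\<^sub>L 'a"
  obtain K where K: "\<And>N. norm (partial_inverse s N o\<^sub>L ?F) \<le> K"
    using partial_inverse_frac_power_bounded[OF s] by blast
  obtain K4 where K4: "\<And>N. norm ((partial_inverse s N o\<^sub>L (?I - T)) - ?G) \<le> K4 * real (Suc N) powr (s - 1)"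
    using partial_inverse_approx[OF s] by blast
  have "(\<lambda>N. K4 * real (Suc N) powr (s - 1)) \<longlonglongrightarrow> 0" using s by real_asymp
  then have "(\<lambda>N. (partial_inverse s N o\<^sub>L (?I - T)) - ?G) \<longlonglongrightarrow> 0"
    by (rule Lim_null_comparison[rotated]) (intro always_eventually allI K4)
  then have lim: "(\<lambda>N. partial_inverse s N o\<^sub>L (?I - T)) \<longlonglongrightarrow> ?G" by (rule Lim_null[THEN iffD2])
  have "(\<lambda>N. (partial_inverse s N o\<^sub>L ?F) y) \<longlonglongrightarrow> y"
  proof (rule blinfun_tendsto_id_dense[OF K dense])
    fix d assume "d \<in> range (\<lambda>y. y - T y)"
    then obtain z where z: "d = z - T z" by blast
    have "T (?F z) = ?F (T z)"
      using compose_frac_power_commute[OF refl s] by (metis blinfun_apply_blinfun_compose)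
    then have "(partial_inverse s N o\<^sub>L ?F) d = (partial_inverse s N o\<^sub>L (?I - T)) (?F z)" for N
      by (simp add: z blinfun.diff_right blinfun.diff_left)
    moreover have "(\<lambda>N. (partial_inverse s N o\<^sub>L (?I - T)) (?F z)) \<longlonglongrightarrow> ?G (?F z)"
      by (intro blinfun.tendsto lim tendsto_const)
    moreover have "?G (?F z) = d"
      using frac_power_compose_complement[OF s] z
      by (metis blinfun.diff_left blinfun_apply_blinfun_compose blinfun_apply_id_blinfun)
    ultimately show "(\<lambda>N. (partial_inverse s N o\<^sub>L ?F) d) \<longlonglongrightarrow> d" by simp
  qed
  then show ?thesis by simp
qed

end

section \<open>Functionals separating points\<close>

text \<open>Homogeneity is asked only as an inequality for \<open>t > 0\<close>, which is easy to
  check for infima; equality follows by scaling back with \<open>1 / t\<close>, as in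
  \<open>sublinearD\<close>.\<close>

definition sublinear :: "('a::real_vector \<Rightarrow> real) \<Rightarrow> bool" where
  "sublinear p \<longleftrightarrow> (\<forall>x y. p (x + y) \<le> p x + p y) \<and> (\<forall>t x. t > 0 \<longrightarrow> p (t *\<^sub>R x) \<le> t * p x) \<and> p 0 = 0"

lemma sublinearD:
  assumes "sublinear p"
  shows "p (x + y) \<le> p x + p y" "t > 0 \<Longrightarrow> p (t *\<^sub>R x) \<le> t * p x" "p 0 = 0"
    "t \<ge> 0 \<Longrightarrow> p (t *\<^sub>R x) = t * p x" "- p (- x) \<le> p x"
proof -
  show *: "p (x + y) \<le> p x + p y" "t > 0 \<Longrightarrow> p (t *\<^sub>R x) \<le> t * p x" "p 0 = 0" for x y t
    using assms by (auto simp: sublinear_def)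
  show "- p (- x) \<le> p x" using *(1)[of x "- x"] *(3) by simp
  show "p (t *\<^sub>R x) = t * p x" if "t \<ge> 0"
  proof (cases "t = 0")
    case False
    with that have t: "t > 0" by simp
    have "p x \<le> (1 / t) * p (t *\<^sub>R x)" using *(2)[of "1 / t" "t *\<^sub>R x"] t by simp
    then have "t * p x \<le> p (t *\<^sub>R x)" using t by (simp add: field_simps)
    with *(2)[OF t, of x] show ?thesis by simp
  qed (simp add: *)
qed

text \<open>Lowering along a ray: \<open>q(x)\<close> is the infimum of
  \<open>p(x + t y) - t p(y)\<close> over \<open>t \<ge> 0\<close>, and \<open>t = 1\<close> gives
  the last claim. A minimal \<open>p\<close> must therefore satisfy
  \<open>p(- y) = - p(y)\<close>.\<close>

lemma sublinear_lower:
  assumes p: "sublinear p"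
  obtains q where "sublinear q" "\<And>x. q x \<le> p x" "q (- y) \<le> - p y"
proof -
  define q where "q = (\<lambda>x. INF t\<in>{0..}. p (x + t *\<^sub>R y) - t * p y)"
  have bdd: "bdd_below ((\<lambda>t. p (x + t *\<^sub>R y) - t * p y) ` {0..})" for x
  proof (rule bdd_belowI2)
    fix t :: real assume "t \<in> {0..}"
    then have "t * p y = p ((x + t *\<^sub>R y) + (- x))" using sublinearD(4)[OF p, of t y] by simp
    also have "\<dots> \<le> p (x + t *\<^sub>R y) + p (- x)" by (rule sublinearD(1)[OF p])
    finally show "- p (- x) \<le> p (x + t *\<^sub>R y) - t * p y" by simp
  qed
  have lower: "q x \<le> p (x + t *\<^sub>R y) - t * p y" if "t \<ge> 0" for x t
    unfolding q_def using that by (intro cINF_lower bdd) auto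
  have greatest: "c \<le> q x" if "\<And>t. t \<ge> 0 \<Longrightarrow> c \<le> p (x + t *\<^sub>R y) - t * p y" for c x
    unfolding q_def by (rule cINF_greatest) (use that in auto)
  have "sublinear q"
    unfolding sublinear_def
  proof (intro conjI allI impI)
    fix x1 x2
    have "q (x1 + x2) - (p (x2 + t' *\<^sub>R y) - t' * p y) \<le> q x1" if t': "t' \<ge> 0" for t'
    proof (rule greatest)
      fix t :: real assume t: "t \<ge> 0"
      have "q (x1 + x2) \<le> p ((x1 + t *\<^sub>R y) + (x2 + t' *\<^sub>R y)) - (t + t') * p y"
        using lower[of "t + t'" "x1 + x2"] t t' by (simp add: algebra_simps)
      also have "\<dots> \<le> p (x1 + t *\<^sub>R y) + p (x2 + t' *\<^sub>R y) - (t + t') * p y"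
        using sublinearD(1)[OF p] by simp
      finally show "q (x1 + x2) - (p (x2 + t' *\<^sub>R y) - t' * p y) \<le> p (x1 + t *\<^sub>R y) - t * p y"
        by (simp add: algebra_simps)
    qed
    then have "q (x1 + x2) - q x1 \<le> q x2" by (intro greatest) (simp add: algebra_simps)
    then show "q (x1 + x2) \<le> q x1 + q x2" by simp
  next
    fix t :: real and x assume t: "t > 0"
    have "q (t *\<^sub>R x) / t \<le> q x"
    proof (rule greatest)
      fix t' :: real assume t': "t' \<ge> 0"
      have "q (t *\<^sub>R x) \<le> p (t *\<^sub>R (x + t' *\<^sub>R y)) - (t * t') * p y"
        using lower[of "t * t'" "t *\<^sub>R x"] t t' by (simp add: algebra_simps)
      also have "\<dots> \<le> t * (p (x + t' *\<^sub>R y) - t' * p y)"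
        using sublinearD(2)[OF p t, of "x + t' *\<^sub>R y"] by (simp add: algebra_simps)
      finally show "q (t *\<^sub>R x) / t \<le> p (x + t' *\<^sub>R y) - t' * p y"
        using t by (simp add: field_simps)
    qed
    then show "q (t *\<^sub>R x) \<le> t * q x" using t by (simp add: field_simps)
  next
    show "q 0 = 0"
    proof (rule antisym)
      show "q 0 \<le> 0" using lower[of 0 0] sublinearD(3)[OF p] by simp
      show "0 \<le> q 0" by (rule greatest) (simp add: sublinearD(4)[OF p])
    qed
  qed
  moreover have "q x \<le> p x" for x using lower[of 0 x] by simp
  moreover have "q (- y) \<le> - p y" using lower[of 1 "- y"] sublinearD(3)[OF p] by simp
  ultimately show thesis by (rule that)
qed

text \<open>Minimal sublinear functionals are odd, hence linear.\<close>

lemma linear_below_sublinear: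
  assumes q: "sublinear q"
  obtains f where "linear f" "\<And>x. f x \<le> q x"
proof -
  define A where "A = {p. sublinear p \<and> (\<forall>x. p x \<le> q x)}"
  define P where "P = (\<lambda>p p' :: 'a \<Rightarrow> real. \<forall>x. p' x \<le> p x)"
  \<comment> \<open>The order \<open>P\<close> is the reversed pointwise order, so a maximal element
    for it is a minimal sublinear functional.\<close>
  have "\<exists>m\<in>A. \<forall>a\<in>A. P m a \<longrightarrow> a = m"
  proof (rule predicate_Zorn)
    show "partial_order_on A (relation_of P A)"
      by (rule partial_order_on_relation_ofI) (auto simp: P_def fun_eq_iff intro: order_trans antisym)
    fix Ch assume "Ch \<in> Chains (relation_of P A)"
    then have chain: "\<And>a b. a \<in> Ch \<Longrightarrow> b \<in> Ch \<Longrightarrow> P a b \<or> P b a" and sub: "Ch \<subseteq> A"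
      unfolding Chains_def relation_of_def by auto
    show "\<exists>u\<in>A. \<forall>a\<in>Ch. P a u"
    proof (cases "Ch = {}")
      case True
      then show ?thesis using q by (auto simp: A_def)
    next
      case False
      define u where "u = (\<lambda>x. INF p\<in>Ch. p x)"
      have chD: "sublinear p" "p x \<le> q x" if "p \<in> Ch" for p x using that sub by (auto simp: A_def)
      have bdd: "bdd_below ((\<lambda>p. p x) ` Ch)" for x
      proof (rule bdd_belowI2)
        fix p assume "p \<in> Ch"
        then show "- q (- x) \<le> p x" using sublinearD(5)[OF chD(1), of p x] chD(2)[of p "- x"] by simp
      qed
      have lower: "u x \<le> p x" if "p \<in> Ch" for p x
        unfolding u_def by (rule cINF_lower[OF bdd that])
      have greatest: "c \<le> u x" if "\<And>p. p \<in> Ch \<Longrightarrow> c \<le> p x" for c x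
        unfolding u_def by (rule cINF_greatest[OF False that])
      have "sublinear u"
        unfolding sublinear_def
      proof (intro conjI allI impI)
        fix x y
        \<comment> \<open>Subadditivity of the infimum needs one member of the chain that lies below
          both \<open>p\<close> and \<open>p'\<close>.\<close>
        have *: "u (x + y) \<le> p x + p' y" if "p \<in> Ch" "p' \<in> Ch" for p p'
        proof -
          have "\<exists>m\<in>Ch. m x \<le> p x \<and> m y \<le> p' y"
            using chain[OF that] that by (auto simp: P_def)
          then obtain m where m: "m \<in> Ch" "m x \<le> p x" "m y \<le> p' y" by blast
          then show ?thesis using lower[OF m(1), of "x + y"] sublinearD(1)[OF chD(1)[OF m(1)], of x y] by simp
        qed
        have "u (x + y) - p' y \<le> u x" if "p' \<in> Ch" for p'
          using *[OF _ that] by (intro greatest) (simp add: algebra_simps)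
        then have "u (x + y) - u x \<le> u y" by (intro greatest) (simp add: algebra_simps)
        then show "u (x + y) \<le> u x + u y" by simp
      next
        fix t :: real and x assume t: "t > 0"
        have "u (t *\<^sub>R x) / t \<le> u x"
        proof (rule greatest)
          fix p assume p: "p \<in> Ch"
          show "u (t *\<^sub>R x) / t \<le> p x"
            using lower[OF p, of "t *\<^sub>R x"] sublinearD(2)[OF chD(1)[OF p] t, of x] t by (simp add: field_simps)
        qed
        then show "u (t *\<^sub>R x) \<le> t * u x" using t by (simp add: field_simps)
      next
        have "(\<lambda>p. p 0) ` Ch = {0}" using False chD(1) sublinearD(3) by force
        then show "u 0 = 0" by (simp add: u_def)
      qed
      moreover have "u x \<le> q x" for x
        using False lower chD(2) order_trans by blast
      ultimately have "u \<in> A" by (simp add: A_def)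
      moreover have "\<forall>a\<in>Ch. P a u" using lower by (auto simp: P_def)
      ultimately show ?thesis by blast
    qed
  qed
  then obtain m where m: "m \<in> A" and min: "\<And>a. a \<in> A \<Longrightarrow> (\<And>x. a x \<le> m x) \<Longrightarrow> a = m"
    by (auto simp: P_def)
  have sm: "sublinear m" and mq: "m x \<le> q x" for x using m by (auto simp: A_def)
  have odd: "m (- y) = - m y" for y
  proof -
    obtain p where p: "sublinear p" "\<And>x. p x \<le> m x" "p (- y) \<le> - m y"
      using sublinear_lower[OF sm, of y] by blast
    have "p \<in> A" using p mq order_trans by (fastforce simp: A_def)
    then have "p = m" by (rule min[OF _ p(2)])
    then show ?thesis using p(3) sublinearD(5)[OF sm, of "y"] by simp
  qed
  have "linear m"
  proof (rule linearI)
    fix x y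
    have "m (- (x + y)) \<le> m (- x) + m (- y)" using sublinearD(1)[OF sm, of "- x" "- y"] by simp
    then have "m x + m y \<le> m (x + y)" unfolding odd by simp
    then show "m (x + y) = m x + m y" using sublinearD(1)[OF sm, of x y] by simp
  next
    fix t x
    show "m (t *\<^sub>R x) = t *\<^sub>R m x"
    proof (cases "t \<ge> 0")
      case False
      then have "m (t *\<^sub>R x) = m (- ((- t) *\<^sub>R x))" by simp
      also have "\<dots> = - ((- t) * m x)" unfolding odd using False by (subst sublinearD(4)[OF sm]) auto
      finally show ?thesis by simp
    qed (simp add: sublinearD(4)[OF sm])
  qed
  then show thesis by (rule that[OF _ mq])
qed

text \<open>Lowering the norm along \<open>z\<close> first forces
  \<open>f (- z) \<le> - norm z\<close> for every linear \<open>f\<close> below it, while the bound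
  by the norm persists.\<close>

lemma real_functional_nonzero:
  fixes z :: "'a::real_normed_vector"
  assumes "z \<noteq> 0"
  obtains f :: "'a \<Rightarrow> real" where "linear f" "\<And>x. \<bar>f x\<bar> \<le> norm x" "f z \<noteq> 0"
proof -
  have "sublinear (norm :: 'a \<Rightarrow> real)"
    by (auto simp: sublinear_def norm_triangle_ineq)
  then obtain q where q: "sublinear q" "\<And>x. q x \<le> norm x" "q (- z) \<le> - norm z"
    using sublinear_lower[where y = z] by blast
  obtain f where f: "linear f" "\<And>x. f x \<le> q x"
    using linear_below_sublinear[OF q(1)] by blast
  have neg: "f (- x) = - f x" for x using f(1) by (rule linear_neg)
  have "\<bar>f x\<bar> \<le> norm x" for x
    using order_trans[OF f(2) q(2), of x] order_trans[OF f(2) q(2), of "- x"] by (simp add: neg)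
  moreover have "f z \<noteq> 0" using order_trans[OF f(2) q(3)] assms by (auto simp: neg)
  ultimately show thesis by (rule that[OF f(1)])
qed

text \<open>A real functional \<open>f\<close> is the real part of the complex-linear map sending
  \<open>x\<close> to \<open>f(x) - i f(i x)\<close>.\<close>

lemma complex_functional_nonzero:
  fixes z :: "'a::complex_banach"
  assumes "z \<noteq> 0"
  obtains \<phi> :: "'a \<Rightarrow>\<^sub>L complex" where "complex_linear \<phi>" "\<phi> z \<noteq> 0"
proof -
  obtain f :: "'a \<Rightarrow> real" where f: "linear f" "\<And>x. \<bar>f x\<bar> \<le> norm x" "f z \<noteq> 0"
    using real_functional_nonzero[OF assms] by blast
  note lin = linear_diff[OF f(1)] linear_add[OF f(1)] linear_scale[OF f(1)] linear_neg[OF f(1)]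
  define g where "g = (\<lambda>x. Complex (f x) (- f (\<i> *\<^sub>C x)))"
  have iR: "c *\<^sub>C (r *\<^sub>R x) = r *\<^sub>R (c *\<^sub>C x)" for c r and x :: 'a
    by (simp add: scaleR_scaleC scaleC_scaleC mult.commute)
  have ii: "\<i> *\<^sub>C (\<i> *\<^sub>C x) = - x" for x :: 'a
    using scaleR_scaleC[of "- 1" x] by (simp add: scaleC_scaleC)
  have "bounded_linear g"
  proof (rule bounded_linear_intro[where K = 2])
    show "g (x + y) = g x + g y" for x y
      by (simp add: g_def complex_eq_iff lin scaleC_add_right)
    show "g (r *\<^sub>R x) = r *\<^sub>R g x" for r x
      by (simp add: g_def complex_eq_iff lin iR)
    show "norm (g x) \<le> norm x * 2" for x
      using cmod_le[of "g x"] f(2)[of x] f(2)[of "\<i> *\<^sub>C x"] by (simp add: g_def norm_scaleC)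
  qed
  then have ap: "blinfun_apply (Blinfun g) = g" by (rule bounded_linear_Blinfun_apply)
  have "complex_linear (Blinfun g)"
    unfolding complex_linear_def ap
  proof (intro allI)
    fix c and x :: 'a
    have "c = of_real (Re c) + of_real (Im c) * \<i>" by (simp add: complex_eq_iff)
    then have "c *\<^sub>C x = (of_real (Re c) + of_real (Im c) * \<i>) *\<^sub>C x"
      by (rule arg_cong[where f = "\<lambda>c. c *\<^sub>C x"])
    then have cx: "c *\<^sub>C x = Re c *\<^sub>R x + Im c *\<^sub>R (\<i> *\<^sub>C x)"
      by (simp only: scaleC_add_left scaleC_scaleC scaleR_scaleC)
    show "g (c *\<^sub>C x) = c *\<^sub>C g x"
      unfolding cx by (simp add: g_def scaleC_complex_def complex_eq_iff lin scaleC_add_right iR ii)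
  qed
  moreover have "Blinfun g z \<noteq> 0" using f(3) unfolding ap by (simp add: g_def complex_eq_iff)
  ultimately show thesis by (rule that)
qed

section \<open>Comparison of the two series\<close>

text \<open>A rate is needed to compare series. Consecutive quotients of \<open>\<tau>\<close> are
  \<open>1 + O(1/n^2)\<close>, because the exponent \<open>b - a\<close> cancels the terms of order
  \<open>1/n\<close>; summing the increments from \<open>n\<close> on leaves
  \<open>O(1/n)\<close>.\<close>

lemma pochhammer_ratio_asymptotics:
  fixes a b :: real
  assumes "a > 0" "b > 0"
  defines "\<tau> \<equiv> \<lambda>n. real n powr (b - a) * (pochhammer a n / pochhammer b n)"
  shows "\<exists>K. \<forall>n\<ge>1. \<bar>\<tau> n - Gamma b / Gamma a\<bar> \<le> K / real n"
proof -
  have lim: "\<tau> \<longlonglongrightarrow> Gamma b / Gamma a"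
  proof -
    have "(\<lambda>n. rGamma_series a n / rGamma_series b n * ((b + n) / (a + n))) \<longlonglongrightarrow> rGamma a / rGamma b * 1"
    proof (intro tendsto_mult tendsto_divide rGamma_series_LIMSEQ)
      show "rGamma b \<noteq> 0" using Gamma_real_pos[OF assms(2)] by (simp add: rGamma_inverse_Gamma)
      show "(\<lambda>n. (b + real n) / (a + real n)) \<longlonglongrightarrow> 1" by real_asymp
    qed
    moreover have "\<forall>\<^sub>F n in sequentially. rGamma_series a n / rGamma_series b n * ((b + n) / (a + n)) = \<tau> n"
      using eventually_gt_at_top[of 0]
    proof eventually_elim
      case (elim n)
      have pos: "pochhammer a n > 0" "pochhammer b n > 0" "a + n > 0" "b + n > 0"
        using assms(1,2) by (auto intro: pochhammer_pos)
      have rG: "rGamma_series c n = pochhammer c n * (c + n) / (fact n * real n powr c)" for c :: real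
        using elim by (simp add: rGamma_series_def pochhammer_Suc powr_def)
      have gen: "(A * u / (F * x)) / (B * v / (F * y)) * (v / u) = y / x * (A / B)"
        if "u \<noteq> 0" "v \<noteq> 0" "F \<noteq> 0" "x \<noteq> 0" "y \<noteq> 0" "B \<noteq> 0" for A B F u v x y :: real
        using that by (simp add: field_simps)
      show ?case
        unfolding rG \<tau>_def powr_diff using pos elim by (intro gen) auto
    qed
    ultimately have "\<tau> \<longlonglongrightarrow> rGamma a / rGamma b * 1" by (rule Lim_transform_eventually)
    then show ?thesis by (simp add: rGamma_inverse_Gamma field_simps)
  qed
  obtain M where M: "M > 0" "\<And>n. \<bar>\<tau> n\<bar> \<le> M"
    using convergent_imp_Bseq[OF convergentI[OF lim]] by (auto elim: BseqE)
  have "(\<lambda>n. (1 + 1 / real n) powr (b - a) * ((a + real n) / (b + real n)) - 1) \<in> O(\<lambda>n. 1 / real n ^ 2)"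
    by real_asymp
  then obtain K0 where K0: "K0 > 0" and "\<forall>\<^sub>F n in sequentially.
      norm ((1 + 1 / real n) powr (b - a) * ((a + real n) / (b + real n)) - 1) \<le> K0 * norm (1 / real n ^ 2)"
    by (elim landau_o.bigE)
  then obtain N0 where N0: "\<And>n. n \<ge> N0 \<Longrightarrow>
      \<bar>(1 + 1 / real n) powr (b - a) * ((a + real n) / (b + real n)) - 1\<bar> \<le> K0 * (1 / real n ^ 2)"
    by (auto simp: eventually_at_top_linorder)
  have step: "\<bar>\<tau> (Suc n) - \<tau> n\<bar> \<le> 2 * M * K0 * (1 / n - 1 / Suc n)" if n: "n \<ge> N0" "n \<ge> 1" for n
  proof -
    have "real (Suc n) powr (b - a) = real n powr (b - a) * (1 + 1 / real n) powr (b - a)"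
    proof -
      have "real (Suc n) = real n * (1 + 1 / real n)" using n by (simp add: distrib_left)
      then show ?thesis by (simp only: powr_mult)
    qed
    then have "\<tau> (Suc n) = \<tau> n * ((1 + 1 / real n) powr (b - a) * ((a + real n) / (b + real n)))"
      unfolding \<tau>_def by (simp add: pochhammer_Suc)
    then have "\<bar>\<tau> (Suc n) - \<tau> n\<bar> =
        \<bar>\<tau> n\<bar> * \<bar>(1 + 1 / real n) powr (b - a) * ((a + real n) / (b + real n)) - 1\<bar>"
      by (simp add: abs_mult[symmetric] right_diff_distrib)
    also have "\<dots> \<le> M * (K0 * (1 / real n ^ 2))"
      using M n by (intro mult_mono N0) auto
    \<comment> \<open>Replaces \<open>1/n^2\<close> by a telescoping majorant.\<close>
    also have "1 / real n ^ 2 \<le> 2 * (1 / n - 1 / Suc n)"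
    proof -
      have "1 / real n - 1 / Suc n = 1 / (real n * Suc n)" using n by (simp add: field_simps)
      moreover have gen: "u / p \<le> v / q" if "u * q \<le> v * p" "p > 0" "q > 0" for u v p q :: real
        using that by (simp add: divide_le_eq le_divide_eq mult_ac)
      have "1 * (real n * Suc n) \<le> 2 * real n ^ 2"
        using n by (simp add: power2_eq_square distrib_left)
      then have "1 / real n ^ 2 \<le> 2 / (real n * Suc n)"
        by (rule gen) (use n in auto)
      ultimately show ?thesis by simp
    qed
    finally show ?thesis using M(1) K0 by (simp add: mult_left_mono mult.assoc mult.left_commute)
  qed
  have tele: "\<bar>\<tau> (n + k) - \<tau> n\<bar> \<le> 2 * M * K0 * (1 / n - 1 / (n + k))" if n: "n \<ge> N0" "n \<ge> 1" for n k
  proof (induction k)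
    case (Suc k)
    have "\<bar>\<tau> (n + Suc k) - \<tau> n\<bar> \<le> \<bar>\<tau> (Suc (n + k)) - \<tau> (n + k)\<bar> + \<bar>\<tau> (n + k) - \<tau> n\<bar>" by simp
    also have "\<dots> \<le> 2 * M * K0 * (1 / (n + k) - 1 / Suc (n + k)) + 2 * M * K0 * (1 / n - 1 / (n + k))"
      using step[of "n + k"] n Suc by simp
    also have "\<dots> = 2 * M * K0 * (1 / n - 1 / (n + Suc k))"
      by (simp add: right_diff_distrib)
    finally show ?case by (simp add: add_ac)
  qed simp
  let ?L = "Gamma b / Gamma a"
  have large: "\<bar>\<tau> n - ?L\<bar> \<le> 2 * M * K0 / n" if n: "n \<ge> N0" "n \<ge> 1" for n
  proof -
    have "(\<lambda>k. \<bar>\<tau> (n + k) - \<tau> n\<bar>) \<longlonglongrightarrow> \<bar>?L - \<tau> n\<bar>"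
      using LIMSEQ_ignore_initial_segment[OF lim, of n] by (intro tendsto_intros) (simp add: add.commute)
    moreover have "\<bar>\<tau> (n + k) - \<tau> n\<bar> \<le> 2 * M * K0 / n" for k
    proof -
      have "2 * M * K0 * (1 / n - 1 / (n + k)) \<le> 2 * M * K0 * (1 / n)"
        using M(1) K0 by (intro mult_left_mono) auto
      with tele[OF n, of k] show ?thesis by simp
    qed
    ultimately have "\<bar>?L - \<tau> n\<bar> \<le> 2 * M * K0 / n" by (intro LIMSEQ_le_const2) auto
    then show ?thesis by (simp add: abs_minus_commute)
  qed
  \<comment> \<open>The finitely many \<open>n < N0\<close> are covered by enlarging the
    constant.\<close>
  have "\<bar>\<tau> n - ?L\<bar> \<le> (2 * M * K0 + (M + \<bar>?L\<bar>) * N0) / n" if n: "n \<ge> 1" for n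
  proof (cases "n \<ge> N0")
    case True
    have "2 * M * K0 / n \<le> (2 * M * K0 + (M + \<bar>?L\<bar>) * N0) / n"
      using M(1) by (intro divide_right_mono) auto
    with large[OF True n] show ?thesis by simp
  next
    case False
    have "\<bar>\<tau> n - ?L\<bar> \<le> M + \<bar>?L\<bar>"
      by (rule order_trans[OF abs_triangle_ineq4 add_right_mono[OF M(2)]])
    then have "\<bar>\<tau> n - ?L\<bar> * n \<le> (M + \<bar>?L\<bar>) * N0"
      using False M(1) by (intro mult_mono) auto
    then have "\<bar>\<tau> n - ?L\<bar> * n \<le> 2 * M * K0 + (M + \<bar>?L\<bar>) * N0"
      using M(1) K0 by (simp add: add_increasing)
    then show ?thesis using n by (simp add: pos_le_divide_eq)
  qed
  then show ?thesis by blast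
qed

lemma Gamma_ratio_asymptotics:
  fixes a b :: real
  assumes "a > 0" "b > 0"
  shows "\<exists>K. \<forall>n\<ge>1. \<bar>Gamma (a + n) / Gamma (b + n) - 1 / real n powr (b - a)\<bar> \<le> K / (real n * real n powr (b - a))"
proof -
  let ?L = "Gamma b / Gamma a"
  have L: "?L > 0" "Gamma a > 0" "Gamma b > 0" using assms by (auto intro!: divide_pos_pos Gamma_real_pos)
  obtain K where K: "\<And>n. n \<ge> 1 \<Longrightarrow> \<bar>real n powr (b - a) * (pochhammer a n / pochhammer b n) - ?L\<bar> \<le> K / real n"
    using pochhammer_ratio_asymptotics[OF assms] by blast
  have "\<bar>Gamma (a + n) / Gamma (b + n) - 1 / real n powr (b - a)\<bar> \<le> K / ?L / (real n * real n powr (b - a))"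
    if n: "n \<ge> 1" for n :: nat
  proof -
    define w where "w = real n powr (b - a)"
    have w: "w > 0" using n by (simp add: w_def)
    have "pochhammer a n / pochhammer b n = ?L * (Gamma (a + n) / Gamma (b + n))"
      using assms by (simp add: pochhammer_Gamma_real)
    then have "w * (pochhammer a n / pochhammer b n) - ?L = (?L * w) * (Gamma (a + n) / Gamma (b + n) - 1 / w)"
      using w by (simp add: right_diff_distrib)
    then have le: "(?L * w) * \<bar>Gamma (a + n) / Gamma (b + n) - 1 / w\<bar> \<le> K / real n"
      using K[OF n] unfolding w_def[symmetric] by (simp only: abs_mult abs_of_pos[OF L(1)] abs_of_pos[OF w])
    have gen: "y \<le> K / l / (m * w)" if "(l * w) * y \<le> K / m" "l > 0" "m > 0" for y l m
      using that w by (simp add: field_simps)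
    show ?thesis unfolding w_def[symmetric] by (rule gen[OF le L(1)]) (use n in simp)
  qed
  then show ?thesis by blast
qed

context cesaro_bounded_operator
begin

text \<open>The coefficients differ by a relative error \<open>O(1/n)\<close> and the Cesaro sums
  are \<open>O(n^\<alpha>)\<close>, so the terms are \<open>O(n^(s-2))\<close>, which is summable as
  \<open>s < 1\<close>. The two series thus converge together, in norm and weakly.\<close>

lemma summable_series_difference:
  assumes s: "0 < s" "s < 1"
  shows "summable (\<lambda>n. norm ((Gamma (s + real (Suc n)) / Gamma (real (Suc n) + \<alpha> + 1)) *\<^sub>R cesaro_sum \<alpha> T (Suc n) x
    - (1 / real (Suc n) powr (1 + \<alpha> - s)) *\<^sub>R cesaro_sum \<alpha> T (Suc n) x))"
proof -
  obtain K where K: "\<And>n. n \<ge> 1 \<Longrightarrow> \<bar>Gamma (s + real n) / Gamma (\<alpha> + 1 + real n) - 1 / real n powr (\<alpha> + 1 - s)\<bar>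
      \<le> K / (real n * real n powr (\<alpha> + 1 - s))"
    using Gamma_ratio_asymptotics[of s "\<alpha> + 1"] s alpha by auto
  obtain K' where K': "K' > 0" "\<And>n. cesaro_number (\<alpha> + 1) n \<le> K' * real (Suc n) powr (\<alpha> + 1 - 1)"
    using cesaro_number_bigo[of "\<alpha> + 1"] alpha by auto
  have K0: "K \<ge> 0" using order_trans[OF abs_ge_zero K[of 1]] by simp
  define Q where "Q = K * (C * (K' * 2 powr \<alpha>) * norm x)"
  show ?thesis
  proof (rule summable_comparison_test'[where N = 0])
    show "summable (\<lambda>n. Q * real (Suc n) powr (s - 2))"
      using s summable_Suc_iff[of "\<lambda>n. real n powr (s - 2)"] summable_real_powr_iff[of "s - 2"]
      by (intro summable_mult) auto
    fix m :: nat
    define n where "n = Suc m"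
    have n: "n \<ge> 1" by (simp add: n_def)
    have "real (Suc n) powr \<alpha> \<le> (2 * real n) powr \<alpha>"
      using n alpha by (intro powr_mono2) auto
    then have "K' * real (Suc n) powr \<alpha> \<le> K' * (2 powr \<alpha> * real n powr \<alpha>)"
      unfolding powr_mult using K'(1) by (intro mult_left_mono) auto
    then have "cesaro_number (\<alpha> + 1) n \<le> K' * (2 powr \<alpha> * real n powr \<alpha>)"
      using K'(2)[of n] unfolding add_diff_cancel_right' by (rule order_trans[rotated])
    then have "norm (cesaro_sum \<alpha> T n) \<le> C * (K' * (2 powr \<alpha> * real n powr \<alpha>))"
      by (rule order_trans[OF norm_cesaro_sum mult_left_mono[OF _ C_nonneg]])
    then have S: "norm (cesaro_sum \<alpha> T n x) \<le> C * (K' * (2 powr \<alpha> * real n powr \<alpha>)) * norm x"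
      by (rule order_trans[OF norm_blinfun mult_right_mono]) simp
    have "norm ((Gamma (s + real n) / Gamma (real n + \<alpha> + 1)) *\<^sub>R cesaro_sum \<alpha> T n x
        - (1 / real n powr (1 + \<alpha> - s)) *\<^sub>R cesaro_sum \<alpha> T n x) =
        \<bar>Gamma (s + real n) / Gamma (\<alpha> + 1 + real n) - 1 / real n powr (\<alpha> + 1 - s)\<bar> * norm (cesaro_sum \<alpha> T n x)"
      by (simp add: scaleR_left_diff_distrib[symmetric] add_ac)
    also have "\<dots> \<le> K / (real n * real n powr (\<alpha> + 1 - s)) * (C * (K' * (2 powr \<alpha> * real n powr \<alpha>)) * norm x)"
      using K0 by (intro mult_mono K n S) auto
    also have "\<dots> = Q * (real n powr \<alpha> / (real n powr 1 * real n powr (\<alpha> + 1 - s)))"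
      using n by (simp add: Q_def)
    also have "real n powr \<alpha> / (real n powr 1 * real n powr (\<alpha> + 1 - s)) = real n powr (s - 2)"
      unfolding powr_add[symmetric] powr_diff[symmetric] by (simp add: algebra_simps)
    finally show "norm (norm ((Gamma (s + real (Suc m)) / Gamma (real (Suc m) + \<alpha> + 1)) *\<^sub>R cesaro_sum \<alpha> T (Suc m) x
        - (1 / real (Suc m) powr (1 + \<alpha> - s)) *\<^sub>R cesaro_sum \<alpha> T (Suc m) x)) \<le> Q * real (Suc m) powr (s - 2)"
      by (simp only: n_def real_norm_def abs_norm_cancel)
  qed
qed

end

section \<open>The range of the fractional power\<close>

context cesaro_bounded_operator
begin

lemma frac_power_inverse_sums:
  assumes dense: "closure (range (\<lambda>y. y - T y)) = UNIV" and s: "0 < s" "s < 1"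
    and x: "x = frac_power \<alpha> s T y"
  shows "(\<lambda>n. inverse_coeff s n *\<^sub>R cesaro_sum \<alpha> T n x) sums y"
    and "frac_power_inverse \<alpha> s T x = y"
proof -
  have "partial_inverse s N x = (\<Sum>n\<le>N. inverse_coeff s n *\<^sub>R cesaro_sum \<alpha> T n x)" for N
    by (simp add: partial_inverse_def blinfun.sum_left blinfun.scaleR_left)
  then show "(\<lambda>n. inverse_coeff s n *\<^sub>R cesaro_sum \<alpha> T n x) sums y"
    using partial_inverse_tendsto[OF dense s, of y] x by (simp add: sums_def_le)
  have "inj (blinfun_apply (frac_power \<alpha> s T))"
  proof (rule injI)
    fix u v assume "frac_power \<alpha> s T u = frac_power \<alpha> s T v"
    then show "u = v"
      using partial_inverse_tendsto[OF dense s, of u] partial_inverse_tendsto[OF dense s, of v]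
      by (auto intro: LIMSEQ_unique)
  qed
  then show "frac_power_inverse \<alpha> s T x = y"
    unfolding frac_power_inverse_def x by (rule the_inv_f_f)
qed

end

text \<open>Multiplication by a complex scalar is a bounded real-linear operator that commutes with
  \<open>T\<close>, hence with the fractional power.\<close>

lemma complex_linear_frac_power:
  fixes T :: "'a::complex_banach \<Rightarrow>\<^sub>L 'a"
  assumes "cesaro_bounded_operator T \<alpha> C" "complex_linear T" "0 < s" "s < 1"
  shows "complex_linear (frac_power \<alpha> s T)"
  unfolding complex_linear_def
proof (intro allI)
  fix c x
  interpret cesaro_bounded_operator T \<alpha> C by (rule assms(1))
  define M where "M = Blinfun (\<lambda>x :: 'a. c *\<^sub>C x)"
  have "bounded_linear (\<lambda>x :: 'a. c *\<^sub>C x)"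
    by (rule bounded_linear_intro[where K = "cmod c"])
      (auto simp: scaleC_add_right scaleR_scaleC scaleC_scaleC mult.commute norm_scaleC)
  then have M: "M x = c *\<^sub>C x" for x
    unfolding M_def by (simp add: bounded_linear_Blinfun_apply)
  have "M o\<^sub>L T = T o\<^sub>L M"
    using assms(2) by (intro blinfun_eqI) (simp add: M complex_linear_def)
  from compose_frac_power_commute[OF this assms(3,4)]
  have "(M o\<^sub>L frac_power \<alpha> s T) x = (frac_power \<alpha> s T o\<^sub>L M) x" by simp
  then show "frac_power \<alpha> s T (c *\<^sub>C x) = c *\<^sub>C frac_power \<alpha> s T x" by (simp add: M)
qed

lemma weak_limit_unique:
  fixes x y :: "'a::complex_banach"
  assumes "\<And>\<phi> :: 'a \<Rightarrow>\<^sub>L complex. complex_linear \<phi> \<Longrightarrow> \<phi> x = \<phi> y"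
  shows "x = y"
proof (rule ccontr)
  assume "x \<noteq> y"
  then obtain \<phi> :: "'a \<Rightarrow>\<^sub>L complex" where "complex_linear \<phi>" "\<phi> (x - y) \<noteq> 0"
    using complex_functional_nonzero[of "x - y"] by auto
  with assms[of \<phi>] show False by (simp add: blinfun.diff_right)
qed

text \<open>The weak sum is tested with the composition of \<open>\<phi>\<close> and the fractional
  power, which is again complex-linear. Commuting the fractional power past
  \<open>partial_inverse\<close> then brings in the strong limit.\<close>

lemma in_range_frac_power_if_weak_sums:
  fixes T :: "'a::complex_banach \<Rightarrow>\<^sub>L 'a"
  assumes op: "cesaro_bounded_operator T \<alpha> C" and T: "complex_linear T"
    and dense: "closure (range (\<lambda>y. y - T y)) = UNIV" and s: "0 < s" "s < 1"
    and weak: "\<And>\<phi> :: 'a \<Rightarrow>\<^sub>L complex. complex_linear \<phi> \<Longrightarrow>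
      (\<lambda>n. \<phi> (cesaro_bounded_operator.inverse_coeff \<alpha> s n *\<^sub>R cesaro_sum \<alpha> T n x)) sums \<phi> y"
  shows "x = frac_power \<alpha> s T y"
proof (rule weak_limit_unique)
  fix \<phi> :: "'a \<Rightarrow>\<^sub>L complex" assume \<phi>: "complex_linear \<phi>"
  interpret cesaro_bounded_operator T \<alpha> C by (rule op)
  let ?F = "frac_power \<alpha> s T"
  have "complex_linear (\<phi> o\<^sub>L ?F)"
    using \<phi> complex_linear_frac_power[OF op T s] by (simp add: complex_linear_def)
  from weak[OF this]
  have "(\<lambda>N. \<Sum>n\<le>N. (\<phi> o\<^sub>L ?F) (inverse_coeff s n *\<^sub>R cesaro_sum \<alpha> T n x)) \<longlonglongrightarrow> (\<phi> o\<^sub>L ?F) y"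
    by (simp add: sums_def_le)
  moreover have "(\<Sum>n\<le>N. (\<phi> o\<^sub>L ?F) (inverse_coeff s n *\<^sub>R cesaro_sum \<alpha> T n x)) = \<phi> (partial_inverse s N (?F x))" for N
  proof -
    have "(\<Sum>n\<le>N. (\<phi> o\<^sub>L ?F) (inverse_coeff s n *\<^sub>R cesaro_sum \<alpha> T n x)) =
        (\<phi> o\<^sub>L ?F) (partial_inverse s N x)"
      unfolding partial_inverse_def blinfun.sum_left blinfun.sum_right blinfun.scaleR_left ..
    also have "\<dots> = \<phi> ((?F o\<^sub>L partial_inverse s N) x)" by simp
    also have "\<dots> = \<phi> (partial_inverse s N (?F x))"
      unfolding partial_inverse_commute[OF s, symmetric] by simp
    finally show ?thesis .
  qed
  ultimately have "(\<lambda>N. \<phi> (partial_inverse s N (?F x))) \<longlonglongrightarrow> \<phi> (?F y)" by simp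
  moreover have "(\<lambda>N. \<phi> (partial_inverse s N (?F x))) \<longlonglongrightarrow> \<phi> x"
    by (intro blinfun.tendsto tendsto_const partial_inverse_tendsto[OF dense s])
  ultimately show "\<phi> x = \<phi> (?F y)" using LIMSEQ_unique by blast
qed

theorem theorem1:
  fixes T :: "'a::complex_banach \<Rightarrow>\<^sub>L 'a" and \<alpha> s :: real and x :: 'a
  assumes "\<alpha> \<ge> 0"
    and "complex_linear T"
    and "cesaro_bounded \<alpha> T"
    and "closure (range (\<lambda>y. y - T y)) = UNIV"
    and "0 < s" and "s < 1"
  defines "in_ran \<equiv> x \<in> range (blinfun_apply (frac_power \<alpha> s T))"
    and "norm_conv \<equiv>
      summable (\<lambda>n. (1 / real (Suc n) powr (1 + \<alpha> - s)) *\<^sub>R cesaro_sum \<alpha> T (Suc n) x)"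
    and "weak_conv \<equiv>
      weakly_summable (\<lambda>n. (1 / real (Suc n) powr (1 + \<alpha> - s)) *\<^sub>R cesaro_sum \<alpha> T (Suc n) x)"
  shows "(in_ran \<longleftrightarrow> norm_conv) \<and> (norm_conv \<longleftrightarrow> weak_conv) \<and>
    (in_ran \<or> norm_conv \<or> weak_conv \<longrightarrow>
       summable (\<lambda>n. (Gamma (s + real n) / Gamma (real n + \<alpha> + 1)) *\<^sub>R cesaro_sum \<alpha> T n x) \<and>
       frac_power_inverse \<alpha> s T x =
         (sin (pi * s) * Gamma (1 - s + \<alpha>) / pi) *\<^sub>R
           (\<Sum>n. (Gamma (s + real n) / Gamma (real n + \<alpha> + 1)) *\<^sub>R cesaro_sum \<alpha> T n x))"
proof -
  note s = \<open>0 < s\<close> \<open>s < 1\<close> and dense = \<open>closure (range (\<lambda>y. y - T y)) = UNIV\<close>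
  obtain C where C: "\<And>n. norm (cesaro_sum \<alpha> T n) / cesaro_number (\<alpha> + 1) n \<le> C"
    using \<open>cesaro_bounded \<alpha> T\<close> unfolding cesaro_bounded_def bdd_above_def by auto
  interpret cesaro_bounded_operator T \<alpha> C
  proof
    show "norm (cesaro_sum \<alpha> T n) \<le> C * cesaro_number (\<alpha> + 1) n" for n
      using C[of n] cesaro_number_pos[of "\<alpha> + 1" n] \<open>\<alpha> \<ge> 0\<close> by (simp add: pos_divide_le_eq)
  qed (rule \<open>\<alpha> \<ge> 0\<close>)
  define c where "c = sin (pi * s) * Gamma (1 - s + \<alpha>) / pi"
  define w where "w = (\<lambda>n. (Gamma (s + real n) / Gamma (real n + \<alpha> + 1)) *\<^sub>R cesaro_sum \<alpha> T n x)"
  define u where "u = (\<lambda>n. (1 / real (Suc n) powr (1 + \<alpha> - s)) *\<^sub>R cesaro_sum \<alpha> T (Suc n) x)"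
  have "sin (pi * s) > 0" using s by (intro sin_gt_zero) auto
  moreover have "Gamma (1 - s + \<alpha>) > 0" using s \<open>\<alpha> \<ge> 0\<close> by (intro Gamma_real_pos) auto
  ultimately have c: "c \<noteq> 0" by (simp add: c_def)
  have b: "inverse_coeff s n *\<^sub>R cesaro_sum \<alpha> T n x = c *\<^sub>R w n" for n
    by (simp add: inverse_coeff_eq_Gamma[OF s] c_def w_def)
  have "summable (\<lambda>n. w (Suc n) - u n)"
    using summable_norm_cancel[OF summable_series_difference[OF s]] by (simp add: w_def u_def)
  then obtain e where e: "(\<lambda>n. w (Suc n) - u n) sums e" by (auto simp: summable_def)
  have ran: "w sums ((1 / c) *\<^sub>R y) \<and> frac_power_inverse \<alpha> s T x = y" if "x = frac_power \<alpha> s T y" for y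
    using sums_scaleR_right[OF frac_power_inverse_sums(1)[OF dense s that], of "1 / c"] c
      frac_power_inverse_sums(2)[OF dense s that] by (simp add: b)
  have formula: "summable w \<and> frac_power_inverse \<alpha> s T x = c *\<^sub>R suminf w" if mem: in_ran
  proof -
    obtain y where "x = frac_power \<alpha> s T y" using mem by (auto simp: in_ran_def)
    from ran[OF this] c show ?thesis by (auto simp: sums_iff)
  qed
  have 1: norm_conv if in_ran
  proof -
    have "summable (\<lambda>n. w (Suc n))" using formula[OF that] by (simp add: summable_Suc_iff)
    from summable_diff[OF this sums_summable[OF e]] show ?thesis by (simp add: norm_conv_def u_def)
  qed
  have 2: weak_conv if norm_conv
    unfolding weak_conv_def weakly_summable_def u_def[symmetric]
    using that blinfun.bounded_linear_right[THEN bounded_linear.sums]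
    by (auto simp: norm_conv_def u_def summable_def)
  have 3: in_ran if weak: weak_conv
  proof -
    obtain y where y: "\<And>\<phi> :: 'a \<Rightarrow>\<^sub>L complex. complex_linear \<phi> \<Longrightarrow> (\<lambda>n. \<phi> (u n)) sums \<phi> y"
      using weak unfolding weak_conv_def weakly_summable_def u_def by blast
    \<comment> \<open>The candidate preimage is the weak sum of the series in the formula:
      \<open>y\<close> from \<open>u\<close>, \<open>e\<close> from the differences
      \<open>w (Suc n) - u n\<close>, and \<open>w 0\<close> because \<open>u n\<close> corresponds
      to \<open>w (Suc n)\<close>.\<close>
    have "(\<lambda>n. \<phi> (inverse_coeff s n *\<^sub>R cesaro_sum \<alpha> T n x)) sums \<phi> (c *\<^sub>R (e + y + w 0))"
      if \<phi>: "complex_linear \<phi>" for \<phi> :: "'a \<Rightarrow>\<^sub>L complex"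
    proof -
      have "(\<lambda>n. \<phi> (w (Suc n) - u n) + \<phi> (u n)) sums (\<phi> e + \<phi> y)"
        by (intro sums_add y \<phi> bounded_linear.sums[OF blinfun.bounded_linear_right e])
      then have "(\<lambda>n. \<phi> (w (Suc n))) sums \<phi> (e + y)"
        by (simp add: blinfun.diff_right blinfun.add_right)
      then have "(\<lambda>n. \<phi> (w n)) sums (\<phi> (e + y) + \<phi> (w 0))"
        by (subst (asm) sums_Suc_iff) simp
      from sums_scaleR_right[OF this, of c] show ?thesis
        by (simp add: b blinfun.scaleR_right blinfun.add_right)
    qed
    then have "x = frac_power \<alpha> s T (c *\<^sub>R (e + y + w 0))"
      by (rule in_range_frac_power_if_weak_sums[OF cesaro_bounded_operator_axioms \<open>complex_linear T\<close> dense s])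
    then show ?thesis by (auto simp: in_ran_def)
  qed
  from 1 2 3 formula show ?thesis unfolding w_def c_def by blast
qed

end
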